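(* Let $\Sigma=\{0,1,\dots,|\Sigma|-1\}$ be both the pattern alphabet and the text alphabet, and let $P\in\Sigma^m$ have parameterized period $\rho$. There is a deterministic algorithm for the streaming parameterized matching problem for $P$ that takes $O(1)$ worst-case time per arriving text character and uses $O(|\Sigma|+\rho)$ words of space. Moreover, any deterministic algorithm for this problem requires $\Omega(|\Sigma|+\rho)$ bits of space.
   Context: Two strings $S,S'$ of equal length $m$ parameterize match (p-match) if there is an injective function $f$ with $S'[j]=f(S[j])$ for all $j$. The parameterized period (p-period) of $P$ is the smallest positive integer $\rho$ such that $P[0..(m-1-\rho)]$ p-matches $P[\rho..m-1]$. In the streaming parameterized matching problem the pattern $P$ is known in advance and the text $T$ arrives one symbol at a time; after $T[i]$ arrives and before $T[i+1]$ arrives, the algorithm must output whether $P$ p-matches $T[(i-m+1)..i]$. The model is the word RAM with word size $\Theta(\log n)$, $n$ the text length.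
   Formalization: The lower bound is proved for |Σ| ≤ m and large |Σ|+ρ, as the worst case over patterns with given |Σ|, m, ρ, with P counted in memory; as stated it fails (m=1 needs 0 bits for any Σ; P=0^(m-1)1 hard-wired needs few bits). *)

theory Defs
  imports Complex_Main "HOL-Library.Monad_Syntax"
begin

section \<open>Parameterized matching\<close>

definition pmatch :: "'a list \<Rightarrow> 'b list \<Rightarrow> bool" where
  "pmatch S S' \<longleftrightarrow>
     length S = length S' \<and>
     (\<exists>f. inj_on f (set S) \<and> (\<forall>j<length S. S' ! j = f (S ! j)))"

definition pperiod :: "'a list \<Rightarrow> nat" where
  "pperiod P = (LEAST \<rho>. 0 < \<rho> \<and> pmatch (take (length P - \<rho>) P) (drop \<rho> P))"

definition patterns :: "nat \<Rightarrow> nat \<Rightarrow> nat \<Rightarrow> nat list set" where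
  "patterns \<sigma> m \<rho> = {P. 0 < m \<and> length P = m \<and> set P \<subseteq> {..<\<sigma>} \<and> pperiod P = \<rho>}"

definition texts :: "nat \<Rightarrow> nat \<Rightarrow> nat list set" where
  "texts \<sigma> n = {T. length T = n \<and> set T \<subseteq> {..<\<sigma>}}"


section \<open>Streaming algorithms\<close>

text \<open>
  The memory of a streaming algorithm is a value of type \<open>'s\<close>. A reaction \<open>\<delta> x s\<close> processes the
  arriving symbol \<open>x\<close> in memory state \<open>s\<close> and yields the new memory state together with the output
  emitted before the next symbol arrives; \<open>None\<close> is a failure (a fault, or running out of the
  allotted time). The pattern is visible to a reaction only through the memory.
\<close>

type_synonym 's reaction = "nat \<Rightarrow> 's \<Rightarrow> ('s \<times> bool) option"

fun stream_run :: "'s reaction \<Rightarrow> 's \<Rightarrow> nat list \<Rightarrow> ('s \<times> bool list) option" where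
  "stream_run \<delta> s [] = Some (s, [])"
| "stream_run \<delta> s (x # xs) =
     do { (s', b) \<leftarrow> \<delta> x s;
          (s'', bs) \<leftarrow> stream_run \<delta> s' xs;
          Some (s'', b # bs) }"

text \<open>The output is negative as long as fewer than \<open>length P\<close> symbols have arrived.\<close>

definition match_at :: "nat list \<Rightarrow> nat list \<Rightarrow> nat \<Rightarrow> bool" where
  "match_at P T i \<longleftrightarrow>
     length P \<le> i + 1 \<and> pmatch P (take (length P) (drop (i + 1 - length P) T))"

definition solves_pmatching ::
    "nat \<Rightarrow> nat \<Rightarrow> nat list \<Rightarrow> 's reaction \<Rightarrow> 's \<Rightarrow> bool" where
  "solves_pmatching \<sigma> n P \<delta> s \<longleftrightarrow>
     (\<forall>T \<in> texts \<sigma> n. \<exists>s'. stream_run \<delta> s T = Some (s', map (match_at P T) [0..<n]))"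


section \<open>The word RAM\<close>

text \<open>
  Memory is an array of words, i.e. of naturals below \<open>2 ^ w\<close>; its length is the space in words,
  and an access outside of it is a fault. Operands of instructions are fixed addresses, so that the
  low cells play the role of registers; \<open>Load\<close> and \<open>Store\<close> are the indirect accesses.
\<close>

datatype binop =
  Add | Sub | Mul | Div | Mod | BitAnd | BitOr | BitXor | ShiftL | ShiftR | Less | Equal

datatype instr =
    Const nat nat            \<comment> \<open>\<open>Const a k\<close>: \<open>M[a] := k\<close>\<close>
  | Binop binop nat nat nat  \<comment> \<open>\<open>Binop f a b c\<close>: \<open>M[a] := f M[b] M[c]\<close>\<close>
  | Load nat nat             \<comment> \<open>\<open>Load a b\<close>: \<open>M[a] := M[M[b]]\<close>\<close>
  | Store nat nat            \<comment> \<open>\<open>Store a b\<close>: \<open>M[M[a]] := M[b]\<close>\<close>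
  | Jump nat                 \<comment> \<open>\<open>Jump l\<close>: continue at instruction \<open>l\<close>\<close>
  | JumpZero nat nat         \<comment> \<open>\<open>JumpZero a l\<close>: continue at instruction \<open>l\<close> if \<open>M[a] = 0\<close>\<close>
  | Halt

fun alu :: "nat \<Rightarrow> binop \<Rightarrow> nat \<Rightarrow> nat \<Rightarrow> nat" where
  "alu w Add x y = (x + y) mod 2 ^ w"
| "alu w Sub x y = (x + 2 ^ w - y) mod 2 ^ w"
| "alu w Mul x y = (x * y) mod 2 ^ w"
| "alu w Div x y = x div y"
| "alu w Mod x y = x mod y"
| "alu w BitAnd x y = and x y"
| "alu w BitOr x y = or x y"
| "alu w BitXor x y = xor x y"
| "alu w ShiftL x y = push_bit y x mod 2 ^ w"
| "alu w ShiftR x y = drop_bit y x"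
| "alu w Less x y = of_bool (x < y)"
| "alu w Equal x y = of_bool (x = y)"

definition mem_read :: "nat list \<Rightarrow> nat \<Rightarrow> nat option" where
  "mem_read M a = (if a < length M then Some (M ! a) else None)"

definition mem_write :: "nat list \<Rightarrow> nat \<Rightarrow> nat \<Rightarrow> nat list option" where
  "mem_write M a v = (if a < length M then Some (M[a := v]) else None)"

text \<open>
  \<open>ram_run w prog t pc M\<close> is the final memory if, started at instruction \<open>pc\<close>, the program halts
  within \<open>t\<close> instructions without a fault, and \<open>None\<close> otherwise.
\<close>

fun ram_run :: "nat \<Rightarrow> instr list \<Rightarrow> nat \<Rightarrow> nat \<Rightarrow> nat list \<Rightarrow> nat list option" where
  "ram_run w prog 0 pc M = None"
| "ram_run w prog (Suc t) pc M =
     (if length prog \<le> pc then None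
      else case prog ! pc of
        Const a k \<Rightarrow>
          do { M' \<leftarrow> mem_write M a (k mod 2 ^ w);
               ram_run w prog t (pc + 1) M' }
      | Binop f a b c \<Rightarrow>
          do { x \<leftarrow> mem_read M b;
               y \<leftarrow> mem_read M c;
               M' \<leftarrow> mem_write M a (alu w f x y);
               ram_run w prog t (pc + 1) M' }
      | Load a b \<Rightarrow>
          do { p \<leftarrow> mem_read M b;
               x \<leftarrow> mem_read M p;
               M' \<leftarrow> mem_write M a x;
               ram_run w prog t (pc + 1) M' }
      | Store a b \<Rightarrow>
          do { p \<leftarrow> mem_read M a;
               x \<leftarrow> mem_read M b;
               M' \<leftarrow> mem_write M p x;
               ram_run w prog t (pc + 1) M' }
      | Jump l \<Rightarrow> ram_run w prog t l M
      | JumpZero a l \<Rightarrow>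
          do { x \<leftarrow> mem_read M a;
               ram_run w prog t (if x = 0 then l else pc + 1) M }
      | Halt \<Rightarrow> Some M)"

text \<open>
  The arriving symbol is placed in cell 0, the program is run from its first instruction for at
  most \<open>t\<close> instructions, and the output is read off cell 1. Only the memory persists between
  arrivals. Preprocessing is represented by its result, the initial memory contents. In the claim
  for one fixed program, nothing non-computable can hide there: given the pattern, the text length,
  the word size and a bound on the number of words, there are finitely many initial contents and
  finitely many texts, so suitable contents can be found by exhaustive search.
\<close>

definition ram_reaction :: "nat \<Rightarrow> instr list \<Rightarrow> nat \<Rightarrow> nat list reaction" where
  "ram_reaction w prog t x M =
     do { M1 \<leftarrow> mem_write M 0 x;
          M2 \<leftarrow> ram_run w prog t 0 M1;
          b \<leftarrow> mem_read M2 1;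
          Some (M2, b \<noteq> 0) }"

end

theory Submission
  imports Defs
begin

text \<open>
  Upper bound. The algorithm is Knuth--Morris--Pratt on the distances to previous occurrences, run
  with a queue and two steps per arrival. Failure links are not stored: the link of a prefix of
  length \<open>q\<close> leads to \<open>q\<close> minus its p-period, and prefixes of equal p-period form at most \<open>\<rho>\<close> levels.
  A whole progression of failures inside one level is skipped by one division, so that every step
  either consumes a symbol or leaves the level downwards. As the level grows by at most one per
  consumed symbol, the queue is never longer than the number of levels still missing to the top one,
  and a match can be reported on time.

  Lower bound. Texts, or patterns, that an algorithm must tell apart lead to different memory
  contents. For \<open>\<sigma>\<close> these are prefixes of a text that use different sets of about \<open>\<sigma> / 4\<close> symbols,
  for \<open>\<rho>\<close> binary patterns of p-period \<open>\<rho>\<close> that do not p-match one another.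
\<close>

section \<open>P-matching and p-periods\<close>

text \<open>Space for about \<open>rho\<close> words holds neither the pattern nor a failure table,
  as \<open>m\<close> can be far larger. Compression is complicated by truncation: a previous
  occurrence may lie before the window, so distances are periodic only up to a cut-off. The same
  cut-off makes the jump inside a level computable: from the first border on, all candidates share
  one table entry up to truncation, so a candidate fails while it is long enough to expose the
  smaller of this entry and the text distance, and succeeds once both symbols look new. A queued
  symbol weighs 2 in the energy because consuming it may raise the level by one; the same weight
  forces the queue to be empty when a match is due.\<close>

definition peq :: "(nat \<Rightarrow> 'a) \<Rightarrow> (nat \<Rightarrow> 'b) \<Rightarrow> nat \<Rightarrow> bool" where
  "peq X Y l \<longleftrightarrow> (\<forall>i<l. \<forall>j<l. X i = X j \<longleftrightarrow> Y i = Y j)"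

text \<open>The injection is recovered by reading \<open>S'\<close> at any position that carries the
  given symbol. Without it, p-matching is an equivalence between functions of the position, and
  windows are shifts.\<close>

lemma pmatch_iff_peq:
  "pmatch S S' \<longleftrightarrow> length S = length S' \<and> peq ((!) S) ((!) S') (length S)"
proof (cases "length S = length S'")
  case True
  have "(\<exists>f. inj_on f (set S) \<and> (\<forall>j<length S. S' ! j = f (S ! j)))"
    if eq: "peq ((!) S) ((!) S') (length S)"
  proof -
    define f where "f a = S' ! (SOME i. i < length S \<and> S ! i = a)" for a
    have f: "f (S ! j) = S' ! j" if "j < length S" for j
    proof -
      have "\<exists>i. i < length S \<and> S ! i = S ! j" using that by blast
      from someI_ex[OF this] show ?thesis
        using eq that unfolding f_def peq_def by blast
    qed
    have "inj_on f (set S)"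
    proof (rule inj_onI)
      fix a b assume "a \<in> set S" "b \<in> set S" and ab: "f a = f b"
      then obtain i j where ij: "i < length S" "S ! i = a" "j < length S" "S ! j = b"
        by (auto simp: in_set_conv_nth)
      then have "S' ! i = S' ! j" using ab f by metis
      then have "S ! i = S ! j" using eq ij unfolding peq_def by blast
      then show "a = b" using ij by simp
    qed
    then show ?thesis using f by metis
  qed
  moreover have "peq ((!) S) ((!) S') (length S)"
    if "inj_on f (set S)" "\<forall>j<length S. S' ! j = f (S ! j)" for f
    using that unfolding peq_def by (simp add: inj_on_eq_iff)
  ultimately show ?thesis using True unfolding pmatch_def by blast
qed (simp add: pmatch_def)

lemma peq_refl: "peq X X l"
  by (simp add: peq_def)

lemma peq_sym: "peq X Y l \<Longrightarrow> peq Y X l"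
  by (auto simp: peq_def)

lemma peq_trans: "peq X Y l \<Longrightarrow> peq Y Z l \<Longrightarrow> peq X Z l"
  by (auto simp: peq_def)

lemma peq_mono: "peq X Y l \<Longrightarrow> l' \<le> l \<Longrightarrow> peq X Y l'"
  by (auto simp: peq_def)

lemma peq_cong:
  "(\<And>i. i < l \<Longrightarrow> X i = X' i) \<Longrightarrow> (\<And>i. i < l \<Longrightarrow> Y i = Y' i) \<Longrightarrow> peq X Y l \<longleftrightarrow> peq X' Y' l"
  by (auto simp: peq_def)

lemma peq_shift:
  "peq X Y l \<Longrightarrow> a + l' \<le> l \<Longrightarrow> peq (\<lambda>i. X (a + i)) (\<lambda>i. Y (a + i)) l'"
  by (auto simp: peq_def)

text \<open>The distance from position \<open>i\<close> back to the previous occurrence of \<open>x\<close>, or \<open>i + 1\<close> if there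
  is none. The latter acts as infinity: passing to a window that starts \<open>y\<close> positions before \<open>i\<close>
  simply truncates the distance at \<open>y + 1\<close>.\<close>

fun dst :: "(nat \<Rightarrow> 'a) \<Rightarrow> nat \<Rightarrow> 'a \<Rightarrow> nat" where
  "dst X 0 x = 1"
| "dst X (Suc i) x = (if X i = x then 1 else Suc (dst X i x))"

lemma dst_pos: "0 < dst X i x"
  by (cases i) auto

lemma dst_le: "dst X i x \<le> Suc i"
  by (induction i) auto

lemma dst_hit: "dst X i x \<le> i \<Longrightarrow> X (i - dst X i x) = x"
proof (induction i)
  case 0
  then show ?case by simp
next
  case (Suc i)
  then show ?case by (auto split: if_splits)
qed

lemma dst_miss: "0 < d \<Longrightarrow> d < dst X i x \<Longrightarrow> X (i - d) \<noteq> x"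
proof (induction i arbitrary: d)
  case (Suc i)
  show ?case
  proof (cases "d = 1")
    case False
    then show ?thesis using Suc.prems Suc.IH[of "d - 1"] by (auto split: if_splits)
  qed (use Suc.prems in \<open>auto split: if_splits\<close>)
qed simp

lemma dst_unique:
  assumes "0 < d" "d \<le> Suc i" "d \<le> i \<Longrightarrow> X (i - d) = x"
    "\<And>c. 0 < c \<Longrightarrow> c < d \<Longrightarrow> X (i - c) \<noteq> x"
  shows "dst X i x = d"
proof (rule linorder_cases)
  assume *: "dst X i x < d"
  with assms(2) have "X (i - dst X i x) = x" by (intro dst_hit) simp
  with assms(4)[OF dst_pos *] show ?thesis by simp
next
  assume *: "d < dst X i x"
  with dst_le[of X i x] assms(3) have "X (i - d) = x" by simp
  with dst_miss[OF assms(1) *] show ?thesis by simp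
qed

definition pdist :: "(nat \<Rightarrow> 'a) \<Rightarrow> nat \<Rightarrow> nat" where
  "pdist X i = dst X i (X i)"

lemma pdist_pos: "0 < pdist X i"
  by (simp add: pdist_def dst_pos)

lemma pdist_le: "pdist X i \<le> Suc i"
  by (simp add: pdist_def dst_le)

lemma pdist_shift: "pdist (\<lambda>i. X (a + i)) y = min (pdist X (a + y)) (Suc y)"
  unfolding pdist_def
proof (rule dst_unique)
  show "0 < min (dst X (a + y) (X (a + y))) (Suc y)" by (simp add: dst_pos)
next
  assume "min (dst X (a + y) (X (a + y))) (Suc y) \<le> y"
  then have *: "dst X (a + y) (X (a + y)) \<le> y" by auto
  then show "X (a + (y - min (dst X (a + y) (X (a + y))) (Suc y))) = X (a + y)"
    using dst_hit[of X "a + y" "X (a + y)"] by (simp add: min_def)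
next
  fix c assume "0 < c" "c < min (dst X (a + y) (X (a + y))) (Suc y)"
  then show "X (a + (y - c)) \<noteq> X (a + y)"
    using dst_miss[of c X "a + y" "X (a + y)"] by simp
qed auto

text \<open>The basis of constant-time extension: comparing two numbers decides whether a match
  grows. If the last symbol occurred before, both strings refer to the same earlier position, whose
  equalities are known; otherwise it is new in both.\<close>

lemma peq_Suc: "peq X Y (Suc l) \<longleftrightarrow> peq X Y l \<and> pdist X l = pdist Y l"
proof (intro iffI conjI)
  assume eq: "peq X Y (Suc l)"
  then show "peq X Y l" by (rule peq_mono) simp
  have *: "X i = X l \<longleftrightarrow> Y i = Y l" if "i \<le> l" for i using eq that by (auto simp: peq_def)
  show "pdist X l = pdist Y l" unfolding pdist_def
  proof (rule dst_unique)
    show "X (l - dst Y l (Y l)) = X l" if "dst Y l (Y l) \<le> l"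
      using *[of "l - dst Y l (Y l)"] dst_hit[OF that] by simp
    show "X (l - c) \<noteq> X l" if "0 < c" "c < dst Y l (Y l)" for c
      using *[of "l - c"] dst_miss[OF that] by simp
  qed (simp_all add: dst_pos dst_le)
next
  assume eq: "peq X Y l \<and> pdist X l = pdist Y l"
  have *: "X i = X l \<longleftrightarrow> Y i = Y l" if "i < l" for i
  proof (cases "pdist X l \<le> l")
    case True
    let ?b = "pdist X l"
    have "X (l - ?b) = X l" using True by (simp add: pdist_def dst_hit)
    moreover have "Y (l - ?b) = Y l" using True eq dst_hit[of Y l "Y l"] by (simp add: pdist_def)
    moreover have "X i = X (l - ?b) \<longleftrightarrow> Y i = Y (l - ?b)"
      using eq that pdist_pos[of X l] by (auto simp: peq_def)
    ultimately show ?thesis by simp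
  next
    case False
    have "0 < l - i" "l - i < pdist X l" using that False by auto
    then have "X (l - (l - i)) \<noteq> X l" "Y (l - (l - i)) \<noteq> Y l"
      using dst_miss eq unfolding pdist_def by metis+
    then show ?thesis using that by simp
  qed
  show "peq X Y (Suc l)" unfolding peq_def
  proof (intro allI impI)
    fix i j assume "i < Suc l" "j < Suc l"
    then consider "i < l" "j < l" | "i < l" "j = l" | "i = l" "j < l" | "i = l" "j = l" by linarith
    then show "X i = X j \<longleftrightarrow> Y i = Y j"
    proof cases
      case 1
      then show ?thesis using eq by (simp add: peq_def)
    next
      case 2
      then show ?thesis using * by simp
    next
      case 3
      then show ?thesis using *[of j] by metis
    qed simp
  qed
qed

section \<open>P-periods of prefixes and distances along a period\<close>

definition per :: "(nat \<Rightarrow> 'a) \<Rightarrow> nat \<Rightarrow> nat" where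
  "per X q = (LEAST p. 0 < p \<and> peq X (\<lambda>i. X (p + i)) (q - p))"

lemma pperiod_eq_per: "pperiod P = per ((!) P) (length P)"
proof -
  have "pmatch (take (length P - p) P) (drop p P) \<longleftrightarrow>
     peq ((!) P) (\<lambda>i. P ! (p + i)) (length P - p)" for p
  proof -
    have "peq ((!) (take (length P - p) P)) ((!) (drop p P)) (length P - p) \<longleftrightarrow>
      peq ((!) P) (\<lambda>i. P ! (p + i)) (length P - p)"
      by (rule peq_cong) auto
    then show ?thesis by (simp add: pmatch_iff_peq)
  qed
  then show ?thesis by (simp add: pperiod_def per_def)
qed

lemma per_valid: shows "0 < per X q" "peq X (\<lambda>i. X (per X q + i)) (q - per X q)"
proof -
  have "0 < Suc q \<and> peq X (\<lambda>i. X (Suc q + i)) (q - Suc q)" by (simp add: peq_def)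
  from LeastI[of "\<lambda>p. 0 < p \<and> peq X (\<lambda>i. X (p + i)) (q - p)", OF this]
  show "0 < per X q" "peq X (\<lambda>i. X (per X q + i)) (q - per X q)" by (simp_all add: per_def)
qed

lemma per_least: "0 < p \<Longrightarrow> peq X (\<lambda>i. X (p + i)) (q - p) \<Longrightarrow> per X q \<le> p"
  unfolding per_def by (rule Least_le) (rule conjI)

lemma per_mono: "q \<le> q' \<Longrightarrow> per X q \<le> per X q'"
  using per_valid[of X q'] by (intro per_least) (auto elim: peq_mono)

lemma per_le: "0 < q \<Longrightarrow> per X q \<le> q"
  by (rule per_least) (simp_all add: peq_def)

lemma pdist_period:
  assumes "peq X (\<lambda>i. X (p + i)) l" "y < l"
  shows "pdist X y = min (pdist X (p + y)) (Suc y)"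
proof -
  have "peq X (\<lambda>i. X (p + i)) (Suc y)" using assms by (auto elim: peq_mono)
  then have "pdist X y = pdist (\<lambda>i. X (p + i)) y" by (simp add: peq_Suc)
  then show ?thesis by (simp add: pdist_shift)
qed

text \<open>The cut-offs of the intermediate steps are weaker than \<open>Suc y\<close>, so only the
  last one remains.\<close>

lemma pdist_period_mult:
  assumes "peq X (\<lambda>i. X (p + i)) (l - p)" "y + k * p < l"
  shows "pdist X y = min (pdist X (y + k * p)) (Suc y)"
  using assms(2)
proof (induction k)
  case 0
  then show ?case using pdist_le[of X y] by simp
next
  case (Suc k)
  have "pdist X (y + k * p) = min (pdist X (p + (y + k * p))) (Suc (y + k * p))"
    using assms(1) Suc.prems by (intro pdist_period) auto
  then show ?case using Suc by (simp add: algebra_simps)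
qed

section \<open>Matching with a queue\<close>

locale pattern =
  fixes X :: "nat \<Rightarrow> nat" and m :: nat
  assumes m_pos: "0 < m"
begin

abbreviation rho :: nat where "rho \<equiv> per X m"

text \<open>The p-periods of the prefixes of the pattern increase with the length of the prefix and take
  at most \<open>rho\<close> values, but the value \<open>rho\<close> may be reached only at a length about
  \<open>rho * sigma\<close>. Hence the prefixes are grouped into levels of equal p-period, and for each level
  only its first length and its period are stored.\<close>

definition level :: "nat \<Rightarrow> nat" where
  "level q = card (per X ` {..q})"

text \<open>As \<open>level\<close> is monotone, the counted set is an initial segment. Its size is
  the first length of level at least \<open>k\<close>, or \<open>Suc m\<close> if no length up to
  \<open>m\<close> reaches that level.\<close>

definition lstart :: "nat \<Rightarrow> nat" where
  "lstart k = card {q. q \<le> m \<and> level q < k}"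

definition lper :: "nat \<Rightarrow> nat" where
  "lper k = per X (lstart k)"

text \<open>Along a residue class modulo \<open>rho\<close> the truncated distances \<open>pdist X y\<close> are \<open>y + 1\<close> up to some
  point and constant afterwards, so one entry per class, read off at its last position, suffices.\<close>

definition dtab :: "nat \<Rightarrow> nat" where
  "dtab r = pdist X (r + (m - 1 - r) div rho * rho)"

lemma rho_pos: "0 < rho"
  by (rule per_valid)

lemma rho_le: "rho \<le> m"
  using m_pos by (rule per_le)

lemma level_mono: "q \<le> q' \<Longrightarrow> level q \<le> level q'"
  unfolding level_def by (intro card_mono image_mono) auto

lemma level_pos: "0 < level q"
  by (auto simp: level_def card_gt_0_iff)

lemma level_Suc: "level (Suc q) \<le> Suc (level q)"
  by (simp add: level_def atMost_Suc card_insert_if)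

lemma level_diff: "level (q + d) \<le> level q + d"
proof (induction d)
  case (Suc d)
  then show ?case using level_Suc[of "q + d"] by simp
qed simp

lemma level_le: "level q \<le> Suc q"
  using card_image_le[of "{..q}" "per X"] by (simp add: level_def)

lemma level_le_rho: "q \<le> m \<Longrightarrow> level q \<le> rho"
proof -
  assume "q \<le> m"
  then have "per X ` {..q} \<subseteq> {1..rho}"
    using per_valid(1)[of X] per_mono[of _ m X] by (force simp: Suc_le_eq)
  then show ?thesis unfolding level_def using card_mono[of "{1..rho}"] by fastforce
qed

lemma less_lstart_iff: "q \<le> m \<Longrightarrow> q < lstart k \<longleftrightarrow> level q < k"
proof -
  assume q: "q \<le> m"
  show ?thesis
  proof
    assume "level q < k"
    then have "{..q} \<subseteq> {q. q \<le> m \<and> level q < k}"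
      using q level_mono by (auto intro: le_less_trans)
    from card_mono[OF _ this] show "q < lstart k" by (simp add: lstart_def Suc_le_eq)
  next
    assume *: "q < lstart k"
    show "level q < k"
    proof (rule ccontr)
      assume "\<not> level q < k"
      then have "{q. q \<le> m \<and> level q < k} \<subseteq> {..<q}"
        using level_mono by (auto simp: not_less intro: leI) (meson level_mono leI le_trans not_le)
      from card_mono[OF _ this] * show False by (simp add: lstart_def)
    qed
  qed
qed

lemma lstart_le: "lstart k \<le> Suc m"
  using card_mono[of "{..m}" "{q. q \<le> m \<and> level q < k}"] by (auto simp: lstart_def)

lemma lstart_1: "lstart (Suc 0) = 0"
  using level_pos by (simp add: lstart_def)

lemma lstart_level_le: "k \<le> level m \<Longrightarrow> lstart k \<le> m"
  using less_lstart_iff[of m k] by simp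

lemma lper_pos: "0 < lper k"
  by (simp add: lper_def per_valid)

lemma lper_le: "k \<le> level m \<Longrightarrow> lper k \<le> rho"
  unfolding lper_def by (intro per_mono lstart_level_le)

text \<open>Between two level starts no new period appears, so the sets of periods up to
  \<open>lstart k\<close> and up to \<open>q\<close> have equal size and coincide; monotonicity of
  \<open>per\<close> does the rest.\<close>

lemma per_eq_lper:
  assumes "q \<le> m" "lstart k \<le> q" "q < lstart (Suc k)"
  shows "per X q = lper k"
proof -
  have "level q = k" using assms less_lstart_iff[of q k] less_lstart_iff[of q "Suc k"] by simp
  moreover have "k \<le> level (lstart k)" using less_lstart_iff[of "lstart k" k] assms by simp
  ultimately have "level (lstart k) = level q" using level_mono[OF assms(2)] by simp
  then have "per X ` {..lstart k} = per X ` {..q}" unfolding level_def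
    using assms(2) by (intro card_subset_eq image_mono) auto
  then have "per X q \<in> per X ` {..lstart k}" by auto
  then have "per X q \<le> lper k" unfolding lper_def by (auto intro: per_mono)
  moreover have "lper k \<le> per X q" unfolding lper_def using assms(2) by (rule per_mono)
  ultimately show ?thesis by simp
qed

lemma dtab_le: "r < rho \<Longrightarrow> dtab r \<le> m"
proof -
  assume "r < rho"
  then have "r + (m - 1 - r) div rho * rho \<le> m - 1"
    using rho_le div_times_less_eq_dividend[of "m - 1 - r" rho] by linarith
  then show ?thesis unfolding dtab_def
    using pdist_le[of X "r + (m - 1 - r) div rho * rho"] m_pos by simp
qed

lemma pdist_dtab:
  assumes "y < m"
  shows "pdist X y = min (dtab (y mod rho)) (Suc y)"
proof -
  define r where "r = y mod rho"
  define k where "k = (m - 1 - r) div rho - y div rho"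
  have y: "y = r + y div rho * rho" unfolding r_def by (rule mod_div_mult_eq[symmetric])
  then have "y div rho * rho \<le> m - 1 - r" using assms by linarith
  then have "y div rho \<le> (m - 1 - r) div rho"
    using div_le_mono[of "y div rho * rho" "m - 1 - r" rho] rho_pos by simp
  then have e: "y + k * rho = r + (m - 1 - r) div rho * rho"
    by (subst y) (simp add: k_def algebra_simps flip: add_mult_distrib)
  have "r \<le> m - 1" using y assms by linarith
  then have "y + k * rho < m"
    unfolding e using div_times_less_eq_dividend[of "m - 1 - r" rho] m_pos by linarith
  then have "pdist X y = min (pdist X (y + k * rho)) (Suc y)"
    by (intro pdist_period_mult[of _ rho m]) (rule per_valid)
  then show ?thesis by (simp add: e dtab_def r_def)
qed

section \<open>Occurrences of pattern prefixes and their borders\<close>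

definition Occ :: "(nat \<Rightarrow> nat) \<Rightarrow> nat \<Rightarrow> nat \<Rightarrow> bool" where
  "Occ T j l \<longleftrightarrow> l \<le> m \<and> l \<le> j \<and> peq X (\<lambda>i. T (j - l + i)) l"

lemma Occ_0: "Occ T j 0"
  by (simp add: Occ_def peq_def)

lemma Occ_prefix: "Occ T i (l + d) \<Longrightarrow> Occ T (i - d) l"
  using peq_mono[of X "\<lambda>j. T (i - (d + l) + j)" "d + l" l] by (auto simp: Occ_def add.commute[of l d])

lemma Occ_prefix_Suc:
  assumes "Occ T i (l + (i - j))" "j < i"
  shows "Occ T (Suc j) (Suc l)"
proof -
  have "l + (i - j) = Suc l + (i - Suc j)" "i - (i - Suc j) = Suc j" using assms(2) by auto
  then show ?thesis using Occ_prefix[of T i "Suc l" "i - Suc j"] assms(1) by metis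
qed

lemma Occ_Suc:
  "Occ T (Suc j) (Suc q) \<longleftrightarrow> q < m \<and> Occ T j q \<and> pdist X q = min (pdist T j) (Suc q)"
  by (auto simp: Occ_def peq_Suc pdist_shift)

lemma Occ_Suc_1: "Occ T (Suc j) (Suc 0)"
  using m_pos by (auto simp: Occ_def peq_def)

text \<open>Both occurrences end at the same place, so their offset \<open>q - l\<close> is a
  p-period of the longer prefix. With \<open>Occ_shift\<close> this makes \<open>q - per X q\<close>
  the next candidate below \<open>q\<close>.\<close>

lemma Occ_border:
  assumes "Occ T j q" "Occ T j l" "l < q"
  shows "l + per X q \<le> q"
proof -
  have "peq (\<lambda>i. X (q - l + i)) (\<lambda>i. T (j - q + (q - l + i))) l"
    using assms by (intro peq_shift[where X = X and l = q]) (auto simp: Occ_def)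
  then have "peq (\<lambda>i. X (q - l + i)) (\<lambda>i. T (j - l + i)) l"
    using assms by (simp add: Occ_def)
  then have "peq X (\<lambda>i. X (q - l + i)) (q - (q - l))"
    using assms by (auto simp: Occ_def intro: peq_trans peq_sym)
  then have "per X q \<le> q - l" using assms(3) by (intro per_least) auto
  then show ?thesis using assms(3) by simp
qed

lemma Occ_shift:
  assumes "Occ T j q" "0 < q"
  shows "Occ T j (q - per X q)"
proof -
  have "peq (\<lambda>i. X (per X q + i)) (\<lambda>i. T (j - q + (per X q + i))) (q - per X q)"
    using assms per_le[of q X] by (intro peq_shift[where X = X and l = q]) (auto simp: Occ_def)
  then have "peq X (\<lambda>i. T (j - (q - per X q) + i)) (q - per X q)"
    using assms per_le[of q X] per_valid(2)[of X q]
    by (auto simp: Occ_def algebra_simps intro: peq_trans)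
  then show ?thesis using assms by (auto simp: Occ_def)
qed

text \<open>Equality of the two distances after truncation at \<open>Suc q\<close>: they agree, or
  both reach outside the window and the symbol is new on both sides.\<close>

definition hit :: "nat \<Rightarrow> nat \<Rightarrow> bool" where
  "hit D q \<longleftrightarrow> q < m \<and> (dtab (q mod rho) = D \<or> q < dtab (q mod rho) \<and> q < D)"

lemma hit_iff: "Occ T j q \<Longrightarrow> hit (pdist T j) q \<longleftrightarrow> Occ T (Suc j) (Suc q)"
proof (cases "q < m")
  case True
  have "(pdist X q = min (pdist T j) (Suc q)) \<longleftrightarrow>
    (dtab (q mod rho) = pdist T j \<or> q < dtab (q mod rho) \<and> q < pdist T j)"
    unfolding pdist_dtab[OF True] by (auto simp: min_def)
  then show "Occ T j q \<Longrightarrow> ?thesis" using True by (simp add: hit_def Occ_Suc)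
qed (simp add: hit_def Occ_Suc)

text \<open>All borders that are reached from \<open>q\<close> inside one level differ by multiples of its period and
  have the same distance entry up to truncation. So if the first border fails, the next candidate
  in the level is found by a division.\<close>

definition fall :: "nat \<Rightarrow> nat \<Rightarrow> nat \<Rightarrow> nat" where
  "fall D k q =
    (if lstart k \<le> q \<and> \<not> hit D q
     then let q1 = q - lper k in
       if lstart k \<le> q1 \<and> \<not> hit D q1
       then let v = max (min (dtab (q1 mod rho)) D) (lstart k)
            in q1 - ((q1 - v) div lper k * lper k + lper k)
       else q1
     else q)"

text \<open>Weaker than the usual invariant: \<open>q\<close> need not be the longest match ending
  at \<open>j\<close>. It only has to bound the lengths that survive all \<open>i - j\<close>
  symbols still queued.\<close>

definition best :: "(nat \<Rightarrow> nat) \<Rightarrow> nat \<Rightarrow> nat \<Rightarrow> nat \<Rightarrow> bool" where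
  "best T i j q \<longleftrightarrow> Occ T j q \<and> (\<forall>l. Occ T i (l + (i - j)) \<longrightarrow> l \<le> q)"

text \<open>A surviving length differs from the failing \<open>y\<close>, so it is shorter and
  \<open>Occ_border\<close> applies. Length 0 never fails, since single symbols always p-match;
  hence the subtraction does not truncate.\<close>

lemma best_descend:
  assumes "j < i" "best T i j y" "\<not> Occ T (Suc j) (Suc y)" "lstart k \<le> y" "y < lstart (Suc k)"
  shows "best T i j (y - lper k) \<and> lper k \<le> y"
proof -
  have occ: "Occ T j y" using assms(2) by (simp add: best_def)
  then have "y \<le> m" by (simp add: Occ_def)
  then have p: "per X y = lper k" using assms(4,5) by (rule per_eq_lper)
  have "0 < y" using assms(3) Occ_Suc_1 by (cases y) auto
  have "l \<le> y - lper k" if l: "Occ T i (l + (i - j))" for l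
  proof -
    have occ': "Occ T (Suc j) (Suc l)" using Occ_prefix_Suc[OF l assms(1)] .
    then have "l < y" using l assms(2,3) unfolding best_def by (metis nat_less_le)
    moreover have "Occ T j l" using occ' by (simp add: Occ_Suc)
    ultimately show ?thesis using Occ_border[OF occ, of l] p by simp
  qed
  then show ?thesis
    using Occ_shift[OF occ \<open>0 < y\<close>] per_le[OF \<open>0 < y\<close>, of X] p by (auto simp: best_def)
qed

context
  fixes T :: "nat \<Rightarrow> nat" and i j q k :: nat
  assumes ji: "j < i" and best: "best T i j q" and qst: "q < lstart (Suc k)"
begin

text \<open>The last two conjuncts exclude negative differences. The program relies on them, since
  machine subtraction wraps around.\<close>

lemma fall_all:
  defines "q' \<equiv> fall (pdist T j) k q"
  shows "best T i j q' \<and> q' \<le> q \<and> (q' < lstart k \<or> Occ T (Suc j) (Suc q')) \<and>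
    (lstart k \<le> q \<longrightarrow> \<not> hit (pdist T j) q \<longrightarrow> lper k \<le> q) \<and>
    (\<forall>q1 v. lstart k \<le> q \<longrightarrow> \<not> hit (pdist T j) q \<longrightarrow> q1 = q - lper k \<longrightarrow>
      lstart k \<le> q1 \<longrightarrow> \<not> hit (pdist T j) q1 \<longrightarrow>
      v = max (min (dtab (q1 mod rho)) (pdist T j)) (lstart k) \<longrightarrow>
      v \<le> q1 \<and> (q1 - v) div lper k * lper k + lper k \<le> q1)"
proof -
  let ?D = "pdist T j" and ?p = "lper k"
  have hit: "hit ?D y \<longleftrightarrow> Occ T (Suc j) (Suc y)" if "best T i j y" for y
    using that hit_iff by (simp add: best_def)
  show ?thesis
  proof (cases "lstart k \<le> q \<and> \<not> hit ?D q")
    case False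
    then show ?thesis using best hit by (auto simp: q'_def fall_def)
  next
    case c1: True
    \<comment> \<open>The period of the prefix of length \<open>q\<close> does not constrain the
      entry at position \<open>q\<close> itself, so the first border is tested on its own and the
      progression starts at \<open>q1\<close>.\<close>
    define q1 where "q1 = q - ?p"
    have b1: "best T i j q1" and pq: "?p \<le> q"
      using best_descend[OF ji best] c1 hit[OF best] qst by (auto simp: q1_def)
    show ?thesis
    proof (cases "lstart k \<le> q1 \<and> \<not> hit ?D q1")
      case False
      then have "q' = q1" using c1 by (auto simp: q'_def fall_def q1_def Let_def)
      then show ?thesis using False b1 hit pq by (auto simp: q1_def)
    next
      case c2: True
      \<comment> \<open>Candidates from \<open>u\<close> upwards expose the difference between entry
        and text distance and fail; below \<open>u\<close> both are cut off alike. The maximum in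
        \<open>v\<close> also stops the descent once it leaves the level.\<close>
      define u where "u = min (dtab (q1 mod rho)) ?D"
      define v where "v = max u (lstart k)"
      have q': "q' = q1 - ((q1 - v) div ?p * ?p + ?p)"
        using c1 c2 by (auto simp: q'_def fall_def q1_def u_def v_def Let_def)
      have "q \<le> m" using best by (simp add: best_def Occ_def)
      then have pq': "per X q = ?p" using c1 qst by (intro per_eq_lper) auto
      have "q1 < q" using lper_pos[of k] pq by (simp add: q1_def)
      then have "q1 < m" using \<open>q \<le> m\<close> by simp
      then have miss1: "dtab (q1 mod rho) \<noteq> ?D" "u \<le> q1"
        using c2 by (auto simp: hit_def u_def)
      have vq: "v \<le> q1" using miss1 c2 by (simp add: v_def)
      have main: "best T i j (q1 - (c * ?p + ?p)) \<and> c * ?p + ?p \<le> q1" if "c * ?p \<le> q1 - v" for c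
        using that
      proof (induction c)
        case 0
        show ?case
          using best_descend[OF ji b1, of k] c2 hit[OF b1] \<open>q1 < q\<close> qst by simp
      next
        case (Suc c)
        define y where "y = q1 - (c * ?p + ?p)"
        have "c * ?p + ?p \<le> q1 - v" using Suc.prems by simp
        then have yv: "v \<le> y" and yp: "c * ?p + ?p + v \<le> q1" using vq by (auto simp: y_def)
        have b: "best T i j y" and yle: "c * ?p + ?p \<le> q1" using Suc by (auto simp: y_def)
        have "y < m" using \<open>q1 < m\<close> by (simp add: y_def)
        have yq: "y + Suc c * ?p = q1" using yle by (simp add: y_def)
        have "pdist X y = min (pdist X (y + Suc c * ?p)) (Suc y)"
          using per_valid(2)[of X q] pq' yq \<open>q1 < q\<close>
          by (intro pdist_period_mult[of _ ?p q]) auto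
        then have "pdist X y = min (dtab (q1 mod rho)) (Suc y)"
          using pdist_dtab[OF \<open>q1 < m\<close>] yq by (simp add: min_def)
        then have "pdist X y \<noteq> min ?D (Suc y)"
          using miss1 yv by (auto simp: v_def u_def min_def split: if_splits)
        then have "\<not> Occ T (Suc j) (Suc y)" by (simp add: Occ_Suc)
        from best_descend[OF ji b this, of k] yv \<open>q1 < q\<close> qst yle
        have "best T i j (y - ?p)" "?p \<le> y" by (auto simp: v_def y_def)
        then show ?case using yle by (auto simp: y_def algebra_simps)
      qed
      define c where "c = (q1 - v) div ?p"
      have cp: "c * ?p \<le> q1 - v" by (simp add: c_def)
      have q'c: "q' = q1 - (c * ?p + ?p)" by (simp add: q' c_def)
      have "q1 - v < c * ?p + ?p"
        unfolding c_def using lper_pos[of k] by (metis add.commute dividend_less_div_times)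
      then have "q' < v" using main[OF cp] q'c by linarith
      have "q' < lstart k \<or> Occ T (Suc j) (Suc q')"
      proof (cases "q' < lstart k")
        case False
        then have "q' < u" using \<open>q' < v\<close> by (simp add: v_def max_def split: if_splits)
        have "q' + Suc c * ?p = q1" using main[OF cp] q'c by simp
        then have "pdist X q' = min (pdist X q1) (Suc q')"
          using per_valid(2)[of X q] pq' \<open>q1 < q\<close>
            pdist_period_mult[of X ?p q q' "Suc c"] by auto
        moreover have "pdist X q1 = min (dtab (q1 mod rho)) (Suc q1)"
          using pdist_dtab[OF \<open>q1 < m\<close>] .
        moreover have "q' \<le> q1" using q' by simp
        ultimately have "pdist X q' = min ?D (Suc q')"
          using \<open>q' < u\<close> miss1 by (auto simp: u_def min_def split: if_splits)
        then show ?thesis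
          using main[OF cp] \<open>q1 < m\<close> q'c by (auto simp: Occ_Suc best_def)
      qed simp
      moreover have "best T i j q'" "q' \<le> q" using main[OF cp] q'c \<open>q1 < q\<close> by auto
      moreover have "v' \<le> q1' \<and> (q1' - v') div ?p * ?p + ?p \<le> q1'"
        if "q1' = q - ?p" "v' = max (min (dtab (q1' mod rho)) ?D) (lstart k)" for q1' v'
        using that vq main[OF cp] by (simp add: c_def v_def u_def flip: q1_def)
      ultimately show ?thesis using pq by blast
    qed
  qed
qed

lemma fall_correct:
  defines "q' \<equiv> fall (pdist T j) k q"
  shows "best T i j q'" "q' \<le> q" "q' < lstart k \<or> Occ T (Suc j) (Suc q')"
  using fall_all by (auto simp: q'_def)

lemma fall_bound1: "lstart k \<le> q \<Longrightarrow> \<not> hit (pdist T j) q \<Longrightarrow> lper k \<le> q"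
  using fall_all by (elim conjE) (rule mp, rule mp)

lemma fall_bound2:
  assumes "lstart k \<le> q" "\<not> hit (pdist T j) q" "q1 = q - lper k" "lstart k \<le> q1" "\<not> hit (pdist T j) q1"
    "v = max (min (dtab (q1 mod rho)) (pdist T j)) (lstart k)"
  shows "v \<le> q1" "(q1 - v) div lper k * lper k + lper k \<le> q1"
proof -
  have "v \<le> q1 \<and> (q1 - v) div lper k * lper k + lper k \<le> q1"
    using fall_all assms by (elim conjE allE[of _ q1] allE[of _ v]) simp
  then show "v \<le> q1" "(q1 - v) div lper k * lper k + lper k \<le> q1" by auto
qed

end

section \<open>The matching automaton and its energy\<close>

text \<open>\<open>k\<close> is only an upper bound on the level of \<open>q\<close>. A fall may
  land several levels lower; further steps then lower \<open>k\<close> one at a time and leave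
  \<open>q\<close> as it is.\<close>

fun step :: "nat \<Rightarrow> nat \<times> nat \<times> nat \<Rightarrow> nat \<times> nat \<times> nat" where
  "step D (q, k, j) =
    (let q' = fall D k q in
     if q' < lstart k then (q', k - 1, j)
     else (Suc q', if Suc q' < lstart (Suc k) then k else Suc k, Suc j))"

fun good :: "(nat \<Rightarrow> nat) \<Rightarrow> nat \<Rightarrow> nat \<times> nat \<times> nat \<Rightarrow> bool" where
  "good T i (q, k, j) \<longleftrightarrow>
     0 < k \<and> k \<le> level m \<and> q < lstart (Suc k) \<and> j \<le> i \<and> Occ T j q \<and>
     (\<forall>l. Occ T i (l + (i - j)) \<longrightarrow> l \<le> q)"

text \<open>Every step with a nonempty queue decreases the energy: it either consumes a queued symbol and
  raises the level by at most one, or it lowers the level. Two steps per arrival therefore keep the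
  energy below \<open>level m\<close>, which bounds the queue by \<open>rho\<close> and empties it at a complete match.\<close>

fun energy :: "nat \<Rightarrow> nat \<times> nat \<times> nat \<Rightarrow> nat" where
  "energy i (q, k, j) = 2 * (i - j) + k"

definition gstep :: "(nat \<Rightarrow> nat) \<Rightarrow> nat \<Rightarrow> nat \<times> nat \<times> nat \<Rightarrow> nat \<times> nat \<times> nat" where
  "gstep T i s = (case s of (q, k, j) \<Rightarrow> if j < i then step (pdist T j) s else s)"

lemma good_step:
  assumes "good T i (q, k, j)" "j < i"
  shows "good T i (step (pdist T j) (q, k, j))"
    "energy i (step (pdist T j) (q, k, j)) < energy i (q, k, j)"
proof -
  define q' where "q' = fall (pdist T j) k q"
  have "best T i j q" "q < lstart (Suc k)" using assms(1) by (auto simp: best_def)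
  note f = fall_correct[OF assms(2) this, folded q'_def]
  have b: "best T i j q'" "q' \<le> q" using f by auto
  have k: "0 < k" "k \<le> level m" "q < lstart (Suc k)" using assms(1) by auto
  have "good T i (step (pdist T j) (q, k, j)) \<and>
    energy i (step (pdist T j) (q, k, j)) < energy i (q, k, j)"
  proof (cases "q' < lstart k")
    case True
    then have "k \<noteq> Suc 0" using lstart_1 by auto
    then show ?thesis using True b k assms
      by (auto simp: best_def Let_def simp flip: q'_def)
  next
    case False
    then have occ: "Occ T (Suc j) (Suc q')" using f by simp
    then have "Suc q' \<le> m" by (simp add: Occ_def)
    have l: "l \<le> Suc q'" if "Occ T i (l + (i - Suc j))" for l
    proof (cases l)
      case (Suc l')
      then have "Occ T i (l' + (i - j))" using that assms(2) by (simp add: Suc_diff_Suc)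
      then show ?thesis using b Suc by (simp add: best_def)
    qed simp
    define k' where "k' = (if Suc q' < lstart (Suc k) then k else Suc k)"
    \<comment> \<open>Raising \<open>k\<close> by one suffices, because one more symbol adds at most
      one new period.\<close>
    have k': "Suc q' < lstart (Suc k') \<and> k' \<le> level m"
    proof (cases "Suc q' < lstart (Suc k)")
      case True
      then show ?thesis using k by (simp add: k'_def)
    next
      case False
      then have "Suc k \<le> level (Suc q')" using less_lstart_iff[OF \<open>Suc q' \<le> m\<close>, of "Suc k"] by simp
      moreover have "level (Suc q') \<le> level m" using \<open>Suc q' \<le> m\<close> by (rule level_mono)
      moreover have "level q' < Suc k"
        using b(2) k(3) \<open>Suc q' \<le> m\<close> less_lstart_iff[of q' "Suc k"] by simp
      moreover have "level (Suc q') \<le> Suc (level q')" by (rule level_Suc)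
      ultimately show ?thesis
        using False \<open>Suc q' \<le> m\<close> less_lstart_iff[of "Suc q'" "Suc (Suc k)"] by (simp add: k'_def)
    qed
    have "step (pdist T j) (q, k, j) = (Suc q', k', Suc j)"
      using False by (simp add: Let_def k'_def flip: q'_def)
    moreover have "2 * (i - Suc j) + k' < 2 * (i - j) + k"
    proof -
      have "k' \<le> Suc k" by (simp add: k'_def)
      then show ?thesis using assms(2) by linarith
    qed
    moreover have "0 < k'" using k by (simp add: k'_def)
    ultimately show ?thesis using k' occ l assms(2) by simp
  qed
  then show "good T i (step (pdist T j) (q, k, j))"
    "energy i (step (pdist T j) (q, k, j)) < energy i (q, k, j)" by auto
qed

lemma good_arrive:
  assumes "good T i (q, k, j)"
  shows "good T (Suc i) (q, k, j)"
proof -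
  have "l \<le> q" if "Occ T (Suc i) (l + (Suc i - j))" for l
  proof -
    have "Occ T i (l + (i - j))"
      using that assms Occ_prefix[of T "Suc i" "l + (i - j)" 1] by (simp add: Suc_diff_le)
    then show ?thesis using assms by simp
  qed
  then show ?thesis using assms by simp
qed

definition tick :: "(nat \<Rightarrow> nat) \<Rightarrow> nat \<Rightarrow> nat \<times> nat \<times> nat \<Rightarrow> nat \<times> nat \<times> nat" where
  "tick T i s = gstep T (Suc i) (gstep T (Suc i) s)"

definition ready :: "(nat \<Rightarrow> nat) \<Rightarrow> nat \<Rightarrow> nat \<times> nat \<times> nat \<Rightarrow> bool" where
  "ready T i s \<longleftrightarrow> good T i s \<and> energy i s \<le> level m"

text \<open>An idle step saves no energy, but then the queue is empty and the energy is just
  \<open>k\<close>, which is at most \<open>level m\<close>.\<close>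

lemma good_gstep:
  assumes "good T i s" "energy i s \<le> Suc e" "level m \<le> e"
  shows "good T i (gstep T i s)" "energy i (gstep T i s) \<le> e"
proof -
  obtain q k j where s: "s = (q, k, j)" by (cases s)
  have "good T i (gstep T i s) \<and> energy i (gstep T i s) \<le> e"
  proof (cases "j < i")
    case True
    then show ?thesis using good_step[of T i q k j] assms by (auto simp: s gstep_def)
  next
    case False
    then show ?thesis using assms by (auto simp: s gstep_def)
  qed
  then show "good T i (gstep T i s)" "energy i (gstep T i s) \<le> e" by auto
qed

lemma ready_arrive:
  assumes "ready T i s"
  shows "good T (Suc i) s" "energy (Suc i) s \<le> Suc (Suc (level m))"
proof -
  obtain q k j where "s = (q, k, j)" by (cases s)
  then show "good T (Suc i) s" "energy (Suc i) s \<le> Suc (Suc (level m))"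
    using assms good_arrive[of T i q k j] by (auto simp: ready_def Suc_diff_le simp del: good.simps)
qed

lemma ready_tick:
  assumes "ready T i s"
  shows "ready T (Suc i) (tick T i s)"
  unfolding ready_def tick_def
  using good_gstep[OF ready_arrive[OF assms]] good_gstep[of T "Suc i" "gstep T (Suc i) s" "level m"]
  by simp

lemma ready_init: "ready T 0 (0, 1, 0)"
proof -
  have "0 < lstart (Suc (Suc 0))"
    using level_le[of 0] less_lstart_iff[of 0 "Suc (Suc 0)"] by simp
  then show ?thesis
    using level_pos[of m] by (auto simp: ready_def Occ_0 Suc_le_eq) (simp add: Occ_def)
qed

text \<open>If \<open>q = m\<close>, then \<open>k\<close> is at least \<open>level m\<close> and
  the energy bound leaves no room for a queue. Conversely, a match forces \<open>q\<close> to be at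
  least \<open>m - (i - j)\<close>, so \<open>level m\<close> is at most \<open>k + (i - j)\<close>;
  as \<open>2 * (i - j) + k\<close> is at most \<open>level m\<close>, the queue is empty.\<close>

lemma ready_output:
  assumes "ready T i (q, k, j)"
  shows "q = m \<longleftrightarrow> Occ T i m"
proof -
  have k: "0 < k" "k \<le> level m" "q < lstart (Suc k)" "j \<le> i" "Occ T j q" "2 * (i - j) + k \<le> level m"
    and cand: "\<And>l. Occ T i (l + (i - j)) \<Longrightarrow> l \<le> q"
    using assms by (auto simp: ready_def)
  have "q \<le> m" using k by (simp add: Occ_def)
  then have ik: "level q \<le> k" using k(3) less_lstart_iff[of q "Suc k"] by simp
  show ?thesis
  proof
    assume "q = m"
    then have "j = i" using k ik by simp
    then show "Occ T i m" using k \<open>q = m\<close> by simp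
  next
    assume *: "Occ T i m"
    have "2 * (i - j) \<le> m" using k level_le[of m] by linarith
    then have "m - (i - j) \<le> q" using cand[of "m - (i - j)"] * by simp
    moreover have "level m \<le> level q + (m - q)" using level_diff[of q "m - q"] \<open>q \<le> m\<close> by simp
    ultimately show "q = m" using k(6) ik \<open>q \<le> m\<close> by linarith
  qed
qed

end

section \<open>Structured programs for the word RAM\<close>

text \<open>Loop-free, so the length of the code bounds the running time, and a program is verified
  by symbolic evaluation of \<open>exec\<close>.\<close>

datatype com =
    Skip
  | Ins instr
  | Seq com com (infixr ";;" 60)
  | Ite nat com com

fun exec_ins :: "nat \<Rightarrow> nat \<Rightarrow> instr \<Rightarrow> (nat \<Rightarrow> nat) \<Rightarrow> (nat \<Rightarrow> nat) option" where
  "exec_ins w N (Const a k) F = (if a < N then Some (F(a := k mod 2 ^ w)) else None)"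
| "exec_ins w N (Binop f a b c) F =
     (if a < N \<and> b < N \<and> c < N then Some (F(a := alu w f (F b) (F c))) else None)"
| "exec_ins w N (Load a b) F =
     (if a < N \<and> b < N \<and> F b < N then Some (F(a := F (F b))) else None)"
| "exec_ins w N (Store a b) F =
     (if a < N \<and> b < N \<and> F a < N then Some (F(F a := F b)) else None)"
| "exec_ins w N _ F = None"

fun exec :: "nat \<Rightarrow> nat \<Rightarrow> com \<Rightarrow> (nat \<Rightarrow> nat) \<Rightarrow> (nat \<Rightarrow> nat) option" where
  "exec w N Skip F = Some F"
| "exec w N (Ins i) F = exec_ins w N i F"
| "exec w N (c ;; d) F = do { F' \<leftarrow> exec w N c F; exec w N d F' }"
| "exec w N (Ite a c d) F =
     (if a < N then if F a \<noteq> 0 then exec w N c F else exec w N d F else None)"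

fun clen :: "com \<Rightarrow> nat" where
  "clen Skip = 0"
| "clen (Ins i) = 1"
| "clen (c ;; d) = clen c + clen d"
| "clen (Ite a c d) = clen c + clen d + 2"

fun code :: "nat \<Rightarrow> com \<Rightarrow> instr list" where
  "code p Skip = []"
| "code p (Ins i) = [i]"
| "code p (c ;; d) = code p c @ code (p + clen c) d"
| "code p (Ite a c d) =
     JumpZero a (p + clen c + 2) # code (p + 1) c @
     Jump (p + clen c + clen d + 2) # code (p + clen c + 2) d"

lemma length_code [simp]: "length (code p c) = clen c"
  by (induction c arbitrary: p) auto

abbreviation mem :: "nat \<Rightarrow> (nat \<Rightarrow> nat) \<Rightarrow> nat list" where
  "mem N F \<equiv> map F [0..<N]"

lemma mem_read_mem: "mem_read (mem N F) a = (if a < N then Some (F a) else None)"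
  by (simp add: mem_read_def)

lemma mem_write_mem: "mem_write (mem N F) a v = (if a < N then Some (mem N (F(a := v))) else None)"
  by (auto simp: mem_write_def intro!: nth_equalityI simp: nth_list_update)

lemma ram_run_ins:
  assumes "exec_ins w N i F = Some F'" "prog ! pc = i" "pc < length prog"
  shows "ram_run w prog (Suc t) pc (mem N F) = ram_run w prog t (Suc pc) (mem N F')"
  using assms by (cases i) (auto simp: mem_read_mem mem_write_mem split: if_splits)

lemma ram_run_jump:
  "prog ! pc = Jump l \<Longrightarrow> pc < length prog \<Longrightarrow> ram_run w prog (Suc t) pc M = ram_run w prog t l M"
  by simp

lemma ram_run_jump_zero:
  "prog ! pc = JumpZero a l \<Longrightarrow> pc < length prog \<Longrightarrow> a < N \<Longrightarrow>
   ram_run w prog (Suc t) pc (mem N F) = ram_run w prog t (if F a = 0 then l else Suc pc) (mem N F)"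
  by (simp add: mem_read_mem)

text \<open>The cost \<open>u\<close> depends neither on the surrounding code nor on the remaining
  fuel \<open>t\<close>; this lets the pieces compose.\<close>

lemma ram_run_code:
  assumes "exec w N c F = Some F'"
  shows "\<exists>u \<le> clen c. \<forall>t pre post.
    length pre = p \<longrightarrow>
    ram_run w (pre @ code p c @ post) (u + t) p (mem N F) =
    ram_run w (pre @ code p c @ post) t (p + clen c) (mem N F')"
  using assms
proof (induction c arbitrary: F F' p)
  case (Ins i)
  show ?case
  proof (intro exI[of _ 1] conjI allI impI)
    fix t and pre post :: "instr list"
    assume "length pre = p"
    then show "ram_run w (pre @ code p (Ins i) @ post) (1 + t) p (mem N F) =
      ram_run w (pre @ code p (Ins i) @ post) t (p + clen (Ins i)) (mem N F')"
      using ram_run_ins[of w N i F F' "pre @ code p (Ins i) @ post" p t] Ins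
      by (simp add: nth_append del: ram_run.simps)
  qed simp
next
  case (Seq c d)
  then obtain G where G: "exec w N c F = Some G" "exec w N d G = Some F'"
    by (auto simp: bind_eq_Some_conv)
  obtain u where u: "u \<le> clen c" "\<And>t pre post. length pre = p \<Longrightarrow>
    ram_run w (pre @ code p c @ post) (u + t) p (mem N F) =
    ram_run w (pre @ code p c @ post) t (p + clen c) (mem N G)"
    using Seq.IH(1)[OF G(1), of p] by blast
  obtain v where v: "v \<le> clen d" "\<And>t pre post. length pre = p + clen c \<Longrightarrow>
    ram_run w (pre @ code (p + clen c) d @ post) (v + t) (p + clen c) (mem N G) =
    ram_run w (pre @ code (p + clen c) d @ post) t (p + clen c + clen d) (mem N F')"
    using Seq.IH(2)[OF G(2), of "p + clen c"] by blast
  show ?case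
  proof (intro exI[of _ "u + v"] conjI allI impI)
    fix t and pre post :: "instr list"
    assume "length pre = p"
    then show "ram_run w (pre @ code p (c ;; d) @ post) (u + v + t) p (mem N F) =
      ram_run w (pre @ code p (c ;; d) @ post) t (p + clen (c ;; d)) (mem N F')"
      using u(2)[of pre "code (p + clen c) d @ post" "v + t"] v(2)[of "pre @ code p c" post t]
      by (simp add: add.assoc del: ram_run.simps)
  qed (use u(1) v(1) in simp)
next
  case (Ite a c d)
  then have a: "a < N" by (simp split: if_splits)
  let ?code = "code p (Ite a c d)"
  show ?case
  proof (cases "F a = 0")
    case True
    then have "exec w N d F = Some F'" using Ite.prems a by simp
    then obtain u where u: "u \<le> clen d" "\<And>t pre post. length pre = p + clen c + 2 \<Longrightarrow>
      ram_run w (pre @ code (p + clen c + 2) d @ post) (u + t) (p + clen c + 2) (mem N F) =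
      ram_run w (pre @ code (p + clen c + 2) d @ post) t (p + clen c + 2 + clen d) (mem N F')"
      using Ite.IH(2)[of F F' "p + clen c + 2"] by blast
    show ?thesis
    proof (intro exI[of _ "Suc u"] conjI allI impI)
      fix t and pre post :: "instr list"
      assume pre: "length pre = p"
      have "ram_run w (pre @ ?code @ post) (Suc u + t) p (mem N F) =
        ram_run w (pre @ ?code @ post) (u + t) (p + clen c + 2) (mem N F)"
        using pre a True ram_run_jump_zero[of "pre @ ?code @ post" p a "p + clen c + 2" N w "u + t" F]
        by (simp add: nth_append del: ram_run.simps)
      also have "\<dots> = ram_run w (pre @ ?code @ post) t (p + clen (Ite a c d)) (mem N F')"
        using pre u(2)[of "pre @ JumpZero a (p + clen c + 2) # code (p + 1) c @
          [Jump (p + clen c + clen d + 2)]" post t]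
        by (simp add: algebra_simps del: ram_run.simps)
      finally show "ram_run w (pre @ ?code @ post) (Suc u + t) p (mem N F) =
        ram_run w (pre @ ?code @ post) t (p + clen (Ite a c d)) (mem N F')" .
    qed (use u(1) in simp)
  next
    case False
    then have "exec w N c F = Some F'" using Ite.prems a by simp
    then obtain u where u: "u \<le> clen c" "\<And>t pre post. length pre = p + 1 \<Longrightarrow>
      ram_run w (pre @ code (p + 1) c @ post) (u + t) (p + 1) (mem N F) =
      ram_run w (pre @ code (p + 1) c @ post) t (p + 1 + clen c) (mem N F')"
      using Ite.IH(1)[of F F' "p + 1"] by blast
    show ?thesis
    proof (intro exI[of _ "Suc (u + 1)"] conjI allI impI)
      fix t and pre post :: "instr list"
      assume pre: "length pre = p"
      have "ram_run w (pre @ ?code @ post) (Suc (u + 1) + t) p (mem N F) =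
        ram_run w (pre @ ?code @ post) (u + Suc t) (p + 1) (mem N F)"
        using pre a False
          ram_run_jump_zero[of "pre @ ?code @ post" p a "p + clen c + 2" N w "u + Suc t" F]
        by (simp add: nth_append del: ram_run.simps)
      also have "\<dots> = ram_run w (pre @ ?code @ post) (Suc t) (p + 1 + clen c) (mem N F')"
        using pre u(2)[of "pre @ [JumpZero a (p + clen c + 2)]"
          "Jump (p + clen c + clen d + 2) # code (p + clen c + 2) d @ post" "Suc t"]
        by (simp del: ram_run.simps)
      also have "\<dots> = ram_run w (pre @ ?code @ post) t (p + clen (Ite a c d)) (mem N F')"
        using pre ram_run_jump[of "pre @ ?code @ post" "p + 1 + clen c"
            "p + clen c + clen d + 2" w t "mem N F'"]
        by (simp add: nth_append algebra_simps del: ram_run.simps)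
      finally show "ram_run w (pre @ ?code @ post) (Suc (u + 1) + t) p (mem N F) =
        ram_run w (pre @ ?code @ post) t (p + clen (Ite a c d)) (mem N F')" .
    qed (use u(1) in simp)
  qed
qed auto

lemma ram_reaction_code:
  assumes "exec w N c (F(0 := x)) = Some F'" "1 < N"
  shows "ram_reaction w (code 0 c @ [Halt]) (Suc (clen c)) x (mem N F) = Some (mem N F', F' 1 \<noteq> 0)"
proof -
  obtain u where u: "u \<le> clen c" "\<And>t post.
    ram_run w (code 0 c @ post) (u + t) 0 (mem N (F(0 := x))) =
    ram_run w (code 0 c @ post) t (clen c) (mem N F')"
    using ram_run_code[OF assms(1), of 0] by auto
  have "ram_run w (code 0 c @ [Halt]) (Suc (clen c)) 0 (mem N (F(0 := x))) = Some (mem N F')"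
    using u(2)[of "[Halt]" "Suc (clen c - u)"] u(1) by (simp add: nth_append)
  then show ?thesis using assms(2)
    by (simp add: ram_reaction_def mem_read_mem mem_write_mem del: ram_run.simps)
qed

section \<open>The matching program\<close>

lemma alu_Add: "x + y < 2 ^ w \<Longrightarrow> alu w Add x y = x + y"
  by simp

lemma alu_Sub: "y \<le> x \<Longrightarrow> x < 2 ^ w \<Longrightarrow> alu w Sub x y = x - y"
  by (simp add: mod_if)

lemma alu_Mul: "x * y < 2 ^ w \<Longrightarrow> alu w Mul x y = x * y"
  by simp

text \<open>These rules and the next ones suffice for truth values, where an operand is 0 or both
  are equal, and for copying by \<open>BitOr\<close> of a cell with itself.\<close>

lemma alu_And: "alu w BitAnd x 0 = 0" "alu w BitAnd 0 y = 0" "alu w BitAnd x x = x"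
  by simp_all

lemma alu_Or: "alu w BitOr x 0 = x" "alu w BitOr 0 y = y" "alu w BitOr x x = x"
  by simp_all

declare alu.simps [simp del]

lemmas alu_word = alu_Add alu_Sub alu_Mul alu_And alu_Or
  alu.simps(4,5) alu.simps(11,12)

abbreviation op2 :: "binop \<Rightarrow> nat \<Rightarrow> nat \<Rightarrow> nat \<Rightarrow> com" where
  "op2 f a b c \<equiv> Ins (Binop f a b c)"

abbreviation mv :: "nat \<Rightarrow> nat \<Rightarrow> com" where
  "mv a b \<equiv> op2 BitOr a b b"

text \<open>Cells: 2, 3, 4 hold the state \<open>(q, k, j)\<close>, 5 the number of arrived symbols, 6 \<open>m\<close>, 7 \<open>rho\<close>,
  8 to 11 the base addresses of the tables \<open>dtab\<close>, \<open>lstart\<close>, \<open>lper\<close> and of the queue, 12 the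
  capacity of the queue, 13 the constant 1, and 14 the base address 32 of the array of last
  occurrences, which stores positions shifted by one with 0 for \<^emph>\<open>never\<close>. Cells 15 to 23 are scratch;
  15 holds the distance code of the symbol at the head of the queue and 16 \<open>lstart k\<close>.\<close>

definition hit_com :: com where
  "hit_com =
    op2 Mod 20 2 7 ;; op2 Add 20 8 20 ;; Ins (Load 21 20) ;;
    op2 Equal 20 21 15 ;; op2 Less 22 2 21 ;; op2 Less 23 2 15 ;;
    op2 BitAnd 22 22 23 ;; op2 BitOr 20 20 22 ;;
    op2 Less 23 2 6 ;; op2 BitAnd 20 20 23"

definition jump_com :: com where
  "jump_com =
    op2 Less 17 21 15 ;; Ite 17 (mv 19 21) (mv 19 15) ;;
    op2 Less 17 19 16 ;; Ite 17 (mv 19 16) Skip ;;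
    op2 Sub 19 2 19 ;; op2 Div 19 19 18 ;; op2 Mul 19 19 18 ;;
    op2 Add 19 19 18 ;; op2 Sub 2 2 19"

definition fall_com :: com where
  "fall_com =
    op2 Less 17 2 16 ;;
    Ite 17 Skip (hit_com ;; Ite 20 Skip (
      op2 Add 18 10 3 ;; Ins (Load 18 18) ;; op2 Sub 2 2 18 ;;
      hit_com ;; op2 Less 17 2 16 ;; op2 BitOr 20 20 17 ;; Ite 20 Skip jump_com))"

definition fetch_com :: com where
  "fetch_com =
    op2 Add 17 4 13 ;; op2 Mod 17 17 12 ;; op2 Add 17 11 17 ;; Ins (Load 15 17) ;;
    op2 Add 17 9 3 ;; Ins (Load 16 17)"

definition advance_com :: com where
  "advance_com =
    op2 Add 2 2 13 ;; op2 Add 4 4 13 ;;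
    op2 Add 17 3 13 ;; op2 Add 17 9 17 ;; Ins (Load 17 17) ;; op2 Less 17 2 17 ;;
    Ite 17 Skip (op2 Add 3 3 13)"

definition step_com :: com where
  "step_com =
    op2 Less 17 4 5 ;;
    Ite 17 (fetch_com ;; fall_com ;; op2 Less 17 2 16 ;; Ite 17 (op2 Sub 3 3 13) advance_com) Skip"

text \<open>The counter is incremented before the subtraction. A stored 0 then yields the number of
  arrived symbols, which is the default value of \<open>dst\<close> for a new symbol.\<close>

definition arrive_com :: com where
  "arrive_com =
    op2 Add 17 14 0 ;; Ins (Load 18 17) ;; op2 Add 5 5 13 ;; op2 Sub 18 5 18 ;;
    Ins (Store 17 5) ;; op2 Mod 17 5 12 ;; op2 Add 17 11 17 ;; Ins (Store 17 18)"

definition main_com :: com where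
  "main_com = arrive_com ;; step_com ;; step_com ;; op2 Equal 1 2 6"

subsection \<open>Correctness of the program\<close>

locale machine = pattern +
  fixes n sz w :: nat
  assumes m_le: "m \<le> n" and fits: "64 * (n + sz) < 2 ^ w"
begin

text \<open>After the 32 low cells and the \<open>sz\<close> last occurrences come
  \<open>rho\<close> cells for \<open>dtab\<close>, \<open>rho + 2\<close> for \<open>lstart\<close>
  (also read at \<open>Suc k\<close>), \<open>rho + 1\<close> for \<open>lper\<close> and
  \<open>rho + 2\<close> for the queue.\<close>

abbreviation mem_size :: nat where "mem_size \<equiv> 37 + sz + 4 * rho"
abbreviation dtab_base :: nat where "dtab_base \<equiv> 32 + sz"
abbreviation lstart_base :: nat where "lstart_base \<equiv> 32 + sz + rho"
abbreviation lper_base :: nat where "lper_base \<equiv> 34 + sz + 2 * rho"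
abbreviation buf_base :: nat where "buf_base \<equiv> 35 + sz + 3 * rho"

definition buf_len :: nat where "buf_len = rho + 2"

definition tables :: "(nat \<Rightarrow> nat) \<Rightarrow> bool" where
  "tables F \<longleftrightarrow>
     F 6 = m \<and> F 7 = rho \<and> F 8 = dtab_base \<and> F 9 = lstart_base \<and> F 10 = lper_base \<and> F 11 = buf_base \<and>
     F 12 = buf_len \<and> F 13 = 1 \<and> F 14 = 32 \<and>
     (\<forall>r<rho. F (dtab_base + r) = dtab r) \<and>
     (\<forall>k\<le>Suc rho. F (lstart_base + k) = lstart k) \<and>
     (\<forall>k\<le>level m. F (lper_base + k) = lper k)"

lemma word_bound: "x \<le> 40 + sz + 4 * n \<Longrightarrow> x < 2 ^ w"
proof -
  assume "x \<le> 40 + sz + 4 * n"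
  \<comment> \<open>Positivity of \<open>n\<close> lets the factor 64 absorb the additive
    40.\<close>
  moreover have "0 < n" using m_pos m_le by simp
  ultimately have "x < 64 * (n + sz)" by (simp only: distrib_left)
  then show ?thesis using fits by simp
qed

lemma rho_n: "0 < rho" "rho \<le> n"
  using rho_pos rho_le m_le by auto

lemma tables_cong:
  assumes "tables F"
    "\<And>a. 6 \<le> a \<and> a \<le> 14 \<or> dtab_base \<le> a \<and> a < buf_base \<Longrightarrow> G a = F a"
  shows "tables G"
  using assms level_le_rho[of m] unfolding tables_def by simp

lemma exec_hit:
  assumes "tables F" "F 2 \<le> m"
  obtains F' where "exec w mem_size hit_com F = Some F'"
    "F' 20 = of_bool (hit (F 15) (F 2))" "F' 21 = dtab (F 2 mod rho)"
    "\<And>a. a \<notin> {20, 21, 22, 23} \<Longrightarrow> F' a = F a"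
proof -
  have t: "F 6 = m" "F 7 = rho" "F 8 = dtab_base" "F (dtab_base + F 2 mod rho) = dtab (F 2 mod rho)"
    using assms rho_pos by (auto simp: tables_def)
  have r: "F 2 mod rho < rho" using rho_pos by simp
  have "dtab_base + F 2 mod rho < 2 ^ w" using r rho_n by (intro word_bound) linarith
  then have "\<exists>F'. exec w mem_size hit_com F = Some F' \<and>
    F' 20 = of_bool (hit (F 15) (F 2)) \<and> F' 21 = dtab (F 2 mod rho) \<and>
    (\<forall>a. a \<notin> {20, 21, 22, 23} \<longrightarrow> F' a = F a)"
    using r by (simp add: hit_com_def t alu_word hit_def)
  then show ?thesis using that by blast
qed

lemma exec_jump:
  assumes v: "v = max (min (F 21) (F 15)) (F 16)" "v \<le> F 2"
    "x = (F 2 - v) div F 18 * F 18 + F 18" "x \<le> F 2" "F 2 < 2 ^ w"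
  obtains F' where "exec w mem_size jump_com F = Some F'" "F' 2 = F 2 - x"
    "\<And>a. a \<notin> {2, 17, 19} \<Longrightarrow> F' a = F a"
proof -
  have b: "(F 2 - v) div F 18 * F 18 < 2 ^ w" "(F 2 - v) div F 18 * F 18 + F 18 < 2 ^ w"
    "(F 2 - v) div F 18 * F 18 + F 18 \<le> F 2"
    using v by linarith+
  have "\<exists>F'. exec w mem_size jump_com F = Some F' \<and> F' 2 = F 2 - x \<and>
    (\<forall>a. a \<notin> {2, 17, 19} \<longrightarrow> F' a = F a)"
  proof (cases "F 21 < F 15")
    case c1: True
    show ?thesis
    proof (cases "F 21 < F 16")
      case True
      then have "v = F 16" using c1 v by simp
      then show ?thesis using c1 True v b by (simp add: jump_com_def alu_word)
    next
      case False
      then have "v = F 21" using c1 v by simp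
      then show ?thesis using c1 False v b by (simp add: jump_com_def alu_word)
    qed
  next
    case c1: False
    show ?thesis
    proof (cases "F 15 < F 16")
      case True
      then have "v = F 16" using c1 v by simp
      then show ?thesis using c1 True v b by (simp add: jump_com_def alu_word)
    next
      case False
      then have "v = F 15" using c1 v by simp
      then show ?thesis using c1 False v b by (simp add: jump_com_def alu_word)
    qed
  qed
  then show ?thesis using that by blast
qed

lemma exec_fall:
  assumes tab: "tables F" and q: "F 2 = q" "q \<le> m" and k: "F 3 = k" "k \<le> level m"
    and S: "F 16 = lstart k" and D: "F 15 = D"
    and p1: "lstart k \<le> q \<Longrightarrow> \<not> hit D q \<Longrightarrow> lper k \<le> q"
    and p2: "\<And>q1 v. \<lbrakk>lstart k \<le> q; \<not> hit D q; q1 = q - lper k; lstart k \<le> q1; \<not> hit D q1;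
      v = max (min (dtab (q1 mod rho)) D) (lstart k)\<rbrakk> \<Longrightarrow>
      v \<le> q1 \<and> (q1 - v) div lper k * lper k + lper k \<le> q1"
  obtains F' where "exec w mem_size fall_com F = Some F'" "F' 2 = fall D k q"
    "\<And>a. a \<notin> {2, 17, 18, 19, 20, 21, 22, 23} \<Longrightarrow> F' a = F a"
proof (cases "q < lstart k")
  case True
  show ?thesis
    by (rule that[of "F(17 := 1)"])
      (use True in \<open>simp_all add: fall_com_def alu_word q S fall_def\<close>)
next
  case c0: False
  define F0 where "F0 = F(17 := 0)"
  have t0: "tables F0" using tab by (simp add: tables_def F0_def)
  then obtain F1 where F1: "exec w mem_size hit_com F0 = Some F1" "F1 20 = of_bool (hit D q)"
    "\<And>a. a \<notin> {20, 21, 22, 23} \<Longrightarrow> F1 a = F0 a"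
    using exec_hit[of F0] q D by (auto simp: F0_def)
  have pre: "exec w mem_size fall_com F =
    exec w mem_size (Ite 20 Skip (
      op2 Add 18 10 3 ;; Ins (Load 18 18) ;; op2 Sub 2 2 18 ;;
      hit_com ;; op2 Less 17 2 16 ;; op2 BitOr 20 20 17 ;; Ite 20 Skip jump_com)) F1"
    using c0 F1(1) by (simp add: fall_com_def alu_word q S F0_def)
  show ?thesis
  proof (cases "hit D q")
    case True
    show ?thesis
      by (rule that[of F1]) (use True F1 pre q in \<open>simp_all add: F0_def fall_def\<close>)
  next
    case c1: False
    define q1 where "q1 = q - lper k"
    have t1: "F1 10 = lper_base" "F1 3 = k" "F1 (lper_base + k) = lper k" "F1 2 = q"
      using tab k q F1(3) by (auto simp: tables_def F0_def)
    have k_rho: "k \<le> rho" using k level_le_rho[of m] by simp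
    have b: "lper_base + k < 2 ^ w" "q < 2 ^ w"
      using k_rho rho_n q m_le by (auto intro!: word_bound)
    define F2 where "F2 = F1(18 := lper k, 2 := q1)"
    have "tables F2" using tab F1(3) by (auto simp: tables_def F0_def F2_def)
    moreover have f2: "F2 2 = q1" "F2 15 = D" "F2 2 \<le> m"
      using q D F1(3) by (auto simp: F0_def F2_def q1_def)
    ultimately obtain F3 where F3: "exec w mem_size hit_com F2 = Some F3" "F3 20 = of_bool (hit D q1)"
      "F3 21 = dtab (q1 mod rho)" "\<And>a. a \<notin> {20, 21, 22, 23} \<Longrightarrow> F3 a = F2 a"
      using exec_hit[of F2] by metis
    define F4 where "F4 = F3(17 := of_bool (q1 < lstart k), 20 := of_bool (hit D q1 \<or> q1 < lstart k))"
    have f4: "F4 2 = q1" "F4 15 = D" "F4 16 = lstart k" "F4 18 = lper k" "F4 21 = dtab (q1 mod rho)"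
      using F3 F1(3) D S by (auto simp: F4_def F2_def F0_def)
    have f4': "F4 a = F a" if "a \<notin> {2, 17, 18, 19, 20, 21, 22, 23}" for a
      using F3(4)[of a] F1(3)[of a] that by (simp add: F4_def F2_def F0_def)
    have pre2: "exec w mem_size fall_com F = exec w mem_size (Ite 20 Skip jump_com) F4"
      using pre c1 F1(2) F3 t1 b k_rho p1 c0 F1(3) S
      by (simp add: alu_word q1_def F2_def F4_def F0_def)
    show ?thesis
    proof (cases "hit D q1 \<or> q1 < lstart k")
      case True
      show ?thesis
        by (rule that[of F4])
          (use True pre2 f4 f4' c0 c1 in \<open>auto simp: F4_def fall_def q1_def Let_def\<close>)
    next
      case False
      define v where "v = max (min (dtab (q1 mod rho)) D) (lstart k)"
      define x where "x = (q1 - v) div lper k * lper k + lper k"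
      have vx: "v \<le> q1" "x \<le> q1"
        using p2[of q1 v] c0 c1 False by (auto simp: q1_def v_def x_def)
      have "v = max (min (F4 21) (F4 15)) (F4 16)" "v \<le> F4 2"
        "x = (F4 2 - v) div F4 18 * F4 18 + F4 18" "x \<le> F4 2"
        using vx unfolding f4 by (simp_all only: v_def x_def)
      moreover have "F4 2 < 2 ^ w" using b by (simp add: f4 q1_def)
      ultimately obtain F5 where F5: "exec w mem_size jump_com F4 = Some F5" "F5 2 = q1 - x"
        "\<And>a. a \<notin> {2, 17, 19} \<Longrightarrow> F5 a = F4 a"
        using exec_jump[where F = F4 and v = v and x = x] f4(1) by metis
      show ?thesis
      proof (rule that[of F5])
        show "exec w mem_size fall_com F = Some F5"
          using pre2 F5(1) False by (simp add: F4_def)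
        show "F5 2 = fall D k q"
          using F5(2) c0 c1 False by (simp add: fall_def q1_def v_def x_def Let_def)
      qed (use F5(3) f4' in auto)
    qed
  qed
qed

fun rep :: "(nat \<Rightarrow> nat) \<Rightarrow> (nat \<Rightarrow> nat) \<Rightarrow> nat \<Rightarrow> nat \<times> nat \<times> nat \<Rightarrow> bool" where
  "rep T F i (q, k, j) \<longleftrightarrow>
     tables F \<and> F 2 = q \<and> F 3 = k \<and> F 4 = j \<and> F 5 = i \<and>
     (\<forall>x<sz. F (32 + x) = Suc i - dst T i x) \<and>
     (\<forall>y. j \<le> y \<and> y < i \<longrightarrow> F (buf_base + Suc y mod buf_len) = pdist T y)"

lemma rep_cong:
  assumes "rep T F i (q, k, j)" "G 2 = q'" "G 3 = k'" "G 4 = j'" "j \<le> j'"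
    "\<And>a. a \<notin> {2, 3, 4} \<union> {15..<32} \<Longrightarrow> G a = F a"
  shows "rep T G i (q', k', j')"
proof -
  have "tables F" using assms(1) by simp
  then have "tables G" by (rule tables_cong) (use assms(6) in auto)
  then show ?thesis using assms by simp
qed

lemma exec_step:
  assumes rep: "rep T F i s" and good: "good T i s" and i: "i \<le> n"
  obtains F' where "exec w mem_size step_com F = Some F'" "rep T F' i (gstep T i s)"
proof -
  obtain q k j where s: "s = (q, k, j)" by (cases s)
  have tab: "tables F" and regs: "F 2 = q" "F 3 = k" "F 4 = j" "F 5 = i"
    using rep by (auto simp: s)
  show ?thesis
  proof (cases "j < i")
    case False
    have "rep T (F(17 := 0)) i (q, k, j)"
      by (rule rep_cong[OF rep[unfolded s]]) (use regs in auto)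
    moreover have "exec w mem_size step_com F = Some (F(17 := 0))"
      using False regs by (simp add: step_com_def alu_word)
    moreover have "gstep T i s = (q, k, j)"
      using False by (simp add: s gstep_def)
    ultimately show ?thesis using that by metis
  next
    case ji: True
    define D where "D = pdist T j"
    have k: "0 < k" "k \<le> level m" "q < lstart (Suc k)" and best: "best T i j q"
      using good by (auto simp: s best_def)
    have "k \<le> rho" using k level_le_rho[of m] by simp
    have "q \<le> m" using best by (simp add: best_def Occ_def)
    define b where "b = Suc j mod buf_len"
    have b: "b < rho + 2" by (simp add: b_def buf_len_def)
    have Fb: "F (buf_base + b) = D"
      using rep ji by (simp add: s b_def D_def)
    have Fs: "F (lstart_base + k) = lstart k" "F (lstart_base + Suc k) = lstart (Suc k)"
      using tab \<open>k \<le> rho\<close> unfolding tables_def by auto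
    have Ft: "F 6 = m" "F 9 = lstart_base" "F 11 = buf_base" "F 12 = buf_len" "F 13 = 1"
      using tab by (auto simp: tables_def)
    have bounds: "Suc j < 2 ^ w" "buf_base + b < 2 ^ w" "lstart_base + k < 2 ^ w"
      "Suc q < 2 ^ w" "Suc k < 2 ^ w" "lstart_base + Suc k < 2 ^ w" "k < 2 ^ w"
      using ji i b rho_n \<open>q \<le> m\<close> m_le \<open>k \<le> rho\<close> by (auto intro!: word_bound)
    define F2 where "F2 = F(15 := D, 17 := lstart_base + k, 16 := lstart k)"
    define rest where "rest = (fall_com ;; op2 Less 17 2 16 ;; Ite 17 (op2 Sub 3 3 13) advance_com)"
    have pre: "exec w mem_size step_com F = exec w mem_size rest F2"
      using ji b bounds \<open>k \<le> rho\<close> Fb Fs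
      by (simp add: step_com_def fetch_com_def alu_word regs Ft F2_def
          flip: rest_def b_def)
    have t2: "tables F2" using tab by (rule tables_cong) (auto simp: F2_def)
    have r2: "F2 2 = q" "F2 3 = k" "F2 16 = lstart k" "F2 15 = D"
      using regs by (simp_all add: F2_def)
    have p1: "lstart k \<le> q \<Longrightarrow> \<not> hit D q \<Longrightarrow> lper k \<le> q"
      unfolding D_def by (rule fall_bound1[OF ji best k(3)])
    have p2: "\<And>q1 v. \<lbrakk>lstart k \<le> q; \<not> hit D q; q1 = q - lper k; lstart k \<le> q1; \<not> hit D q1;
        v = max (min (dtab (q1 mod rho)) D) (lstart k)\<rbrakk> \<Longrightarrow>
        v \<le> q1 \<and> (q1 - v) div lper k * lper k + lper k \<le> q1"
      unfolding D_def
      by (rule conjI) (rule fall_bound2[OF ji best k(3)]; assumption)+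
    obtain F3 where F3: "exec w mem_size fall_com F2 = Some F3" "F3 2 = fall D k q"
      "\<And>a. a \<notin> {2, 17, 18, 19, 20, 21, 22, 23} \<Longrightarrow> F3 a = F2 a"
      using exec_fall[OF t2 r2(1) \<open>q \<le> m\<close> r2(2) k(2) r2(3,4) p1 p2] by blast
    define q' where "q' = fall D k q"
    have "q' \<le> q" unfolding q'_def D_def using fall_correct(2)[OF ji best k(3)] .
    have f3: "F3 2 = q'" "F3 3 = k" "F3 4 = j" "F3 16 = lstart k" "F3 13 = 1" "F3 9 = lstart_base"
      "F3 (lstart_base + Suc k) = lstart (Suc k)"
      using F3 Ft regs Fs by (auto simp: F2_def q'_def)
    have f3': "F3 a = F a" if "a \<notin> {2, 3, 4} \<union> {15..<32}" for a
    proof -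
      have "a \<notin> {2, 17, 18, 19, 20, 21, 22, 23}" "a \<noteq> 15" "a \<noteq> 16" using that by auto
      then show ?thesis using F3(3)[of a] by (simp add: F2_def)
    qed
    show ?thesis
    proof (cases "q' < lstart k")
      case True
      show ?thesis
      proof (rule that)
        show "exec w mem_size step_com F = Some (F3(17 := 1, 3 := k - 1))"
          using True k bounds by (simp add: pre rest_def F3(1) alu_word f3)
        have "rep T (F3(17 := 1, 3 := k - 1)) i (q', k - 1, j)"
          using f3 f3' by (intro rep_cong[OF rep[unfolded s]]) auto
        moreover have "gstep T i s = (q', k - 1, j)"
          using ji True by (simp add: s gstep_def Let_def q'_def D_def)
        ultimately show "rep T (F3(17 := 1, 3 := k - 1)) i (gstep T i s)" by simp
      qed
    next
      case False
      define c where "c = (if Suc q' < lstart (Suc k) then k else Suc k)"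
      define G where "G = F3(2 := Suc q', 4 := Suc j, 17 := of_bool (Suc q' < lstart (Suc k)))"
      define F4 where "F4 = (if Suc q' < lstart (Suc k) then G else G(3 := Suc k))"
      have f4: "F4 2 = Suc q'" "F4 3 = c" "F4 4 = Suc j"
        using f3 by (auto simp: F4_def G_def c_def)
      have f4': "F4 a = F a" if "a \<notin> {2, 3, 4} \<union> {15..<32}" for a
        using f3'[OF that] that by (auto simp: F4_def G_def)
      have bq: "Suc q' < 2 ^ w" using \<open>q' \<le> q\<close> bounds by linarith
      show ?thesis
      proof (rule that)
        show "exec w mem_size step_com F = Some F4"
          using False k bounds bq \<open>k \<le> rho\<close> f3
          by (simp add: pre rest_def F3(1) advance_com_def alu_word F4_def G_def)
        have "rep T F4 i (Suc q', c, Suc j)"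
          using f4' by (intro rep_cong[OF rep[unfolded s] f4]) auto
        moreover have "gstep T i s = (Suc q', c, Suc j)"
          using ji False by (simp add: s gstep_def Let_def q'_def D_def c_def)
        ultimately show "rep T F4 i (gstep T i s)" by simp
      qed
    qed
  qed
qed

lemma exec_arrive:
  assumes rep: "rep T F i s" and ready: "ready T i s" and i: "i < n" and x: "T i < sz"
  obtains F' where "exec w mem_size arrive_com (F(0 := T i)) = Some F'" "rep T F' (Suc i) s"
proof -
  obtain q k j where s: "s = (q, k, j)" by (cases s)
  have tab: "tables F" and regs: "F 2 = q" "F 3 = k" "F 4 = j" "F 5 = i"
    and last: "\<And>x. x < sz \<Longrightarrow> F (32 + x) = Suc i - dst T i x"
    and buf: "\<And>y. j \<le> y \<Longrightarrow> y < i \<Longrightarrow> F (buf_base + Suc y mod buf_len) = pdist T y"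
    using rep by (auto simp: s)
  define b where "b = Suc i mod buf_len"
  have b: "b < rho + 2" by (simp add: b_def buf_len_def)
  have Ft: "F 11 = buf_base" "F 12 = buf_len" "F 13 = 1" "F 14 = 32"
    using tab by (auto simp: tables_def)
  have ij: "j \<le> i" "i - j \<le> rho"
    using ready level_le_rho[of m] by (auto simp: ready_def s)
  have d: "0 < pdist T i" "pdist T i \<le> Suc i" by (rule pdist_pos pdist_le)+
  have bounds: "Suc i < 2 ^ w" "32 + T i < 2 ^ w" "buf_base + b < 2 ^ w"
    using i x b rho_n by (auto intro!: word_bound)
  define F' where "F' = F(0 := T i, 5 := Suc i, 18 := pdist T i,
    32 + T i := Suc i, 17 := buf_base + b, buf_base + b := pdist T i)"
  have e: "exec w mem_size arrive_com (F(0 := T i)) = Some F'"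
    using bounds b d x last[OF x]
    by (simp add: arrive_com_def alu_word Ft regs F'_def pdist_def flip: b_def)
  have "tables F'" using tab by (rule tables_cong) (use x in \<open>auto simp: F'_def\<close>)
  moreover have "F' (32 + y) = Suc (Suc i) - dst T (Suc i) y" if "y < sz" for y
    using that last x by (simp add: F'_def)
  moreover have "F' (buf_base + Suc y mod buf_len) = pdist T y" if "j \<le> y" "y < Suc i" for y
  proof (cases "y = i")
    case False
    \<comment> \<open>At most \<open>rho\<close> symbols wait before an arrival, so queued positions
      differ by less than \<open>buf_len\<close> and use different slots.\<close>
    then have "Suc y mod buf_len \<noteq> b"
      unfolding b_def using that ij mod_eq_dvd_iff_nat[of "Suc y" "Suc i" buf_len]
      by (auto dest!: dvd_imp_le simp: buf_len_def)
    then show ?thesis using that False buf[of y] x by (simp add: F'_def)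
  qed (simp add: F'_def b_def)
  ultimately have "rep T F' (Suc i) s"
    using regs x by (simp add: s) (simp add: F'_def)
  then show ?thesis using e that by blast
qed

lemma exec_main:
  assumes rep: "rep T F i s" and ready: "ready T i s" and i: "i < n" and x: "T i < sz"
  obtains F' where "exec w mem_size main_com (F(0 := T i)) = Some F'" "rep T F' (Suc i) (tick T i s)"
    "F' 1 \<noteq> 0 \<longleftrightarrow> Occ T (Suc i) m"
proof -
  obtain F1 where F1: "exec w mem_size arrive_com (F(0 := T i)) = Some F1" "rep T F1 (Suc i) s"
    using exec_arrive[OF assms] .
  obtain F2 where F2: "exec w mem_size step_com F1 = Some F2" "rep T F2 (Suc i) (gstep T (Suc i) s)"
    using exec_step[OF F1(2) ready_arrive(1)[OF ready]] i by auto
  have g: "good T (Suc i) (gstep T (Suc i) s)"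
    using good_gstep(1)[OF ready_arrive[OF ready]] by simp
  obtain F3 where F3: "exec w mem_size step_com F2 = Some F3" "rep T F3 (Suc i) (tick T i s)"
    using exec_step[OF F2(2) g] i by (auto simp: tick_def)
  obtain q k j where s: "tick T i s = (q, k, j)" by (cases "tick T i s")
  define F4 where "F4 = F3(1 := of_bool (F3 2 = F3 6))"
  have f3: "F3 2 = q" "F3 6 = m" using F3(2) by (auto simp: s tables_def)
  show ?thesis
  proof (rule that)
    show "exec w mem_size main_com (F(0 := T i)) = Some F4"
      by (simp add: main_com_def F1(1) F2(1) F3(1) alu_word F4_def)
    have "tables F3" using F3(2) by (simp add: s)
    then have "tables F4" by (rule tables_cong) (auto simp: F4_def)
    then show "rep T F4 (Suc i) (tick T i s)" using F3(2) by (simp add: s F4_def)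
    show "F4 1 \<noteq> 0 \<longleftrightarrow> Occ T (Suc i) m"
      using ready_output[of T "Suc i" q k j] ready_tick[OF ready] f3 by (simp add: s F4_def)
  qed
qed

end

section \<open>Initial memory and the complete run\<close>

context machine
begin

definition init_mem :: "nat \<Rightarrow> nat" where
  "init_mem a =
    (if a < 15 then [0, 0, 0, 1, 0, 0, m, rho, dtab_base, lstart_base, lper_base, buf_base, buf_len, 1, 32] ! a
     else if a < dtab_base then 0
     else if a < lstart_base then dtab (a - dtab_base)
     else if a < lper_base then lstart (a - lstart_base)
     else if a < buf_base \<and> a - lper_base \<le> level m then lper (a - lper_base)
     else 0)"

lemma init_mem_bound: "init_mem a < 2 ^ w"
proof (rule word_bound)
  have "a - dtab_base < rho" if "\<not> a < dtab_base" "a < lstart_base" using that by simp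
  then have "dtab (a - dtab_base) \<le> n" if "\<not> a < dtab_base" "a < lstart_base"
    using that dtab_le[of "a - dtab_base"] m_le by simp
  moreover have "lstart (a - lstart_base) \<le> Suc n" using lstart_le[of "a - lstart_base"] m_le by simp
  moreover have "lper (a - lper_base) \<le> n" if "a - lper_base \<le> level m"
    using that lper_le rho_n by (meson le_trans)
  moreover have
    "[0, 0, 0, 1, 0, 0, m, rho, dtab_base, lstart_base, lper_base, buf_base, buf_len, 1, 32] ! a \<le> 40 + sz + 4 * n"
    if a: "a < 15"
  proof -
    have le: "x \<le> 40 + sz + 4 * n"
      if "x \<in> set [0, 0, 0, 1, 0, 0, m, rho, dtab_base, lstart_base, lper_base, buf_base, buf_len, 1, 32]" for x
      using that rho_n m_le by (auto simp: buf_len_def)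
    show ?thesis by (rule le[OF nth_mem]) (use a in simp)
  qed
  ultimately show "init_mem a \<le> 40 + sz + 4 * n" by (auto simp: init_mem_def intro: le_trans)
qed

lemma init_mem_rep: "rep T init_mem 0 (0, 1, 0)"
proof -
  have "level m \<le> rho" by (simp add: level_le_rho)
  then have "tables init_mem" by (auto simp: tables_def init_mem_def)
  moreover have "init_mem 2 = 0" "init_mem 3 = 1" "init_mem 4 = 0" "init_mem 5 = 0" "\<forall>x<sz. init_mem (32 + x) = 0"
    by (simp_all add: init_mem_def)
  ultimately show ?thesis by simp
qed

end

abbreviation matcher :: "instr list" where
  "matcher \<equiv> code 0 main_com @ [Halt]"

lemma match_at_Occ:
  assumes "pattern (length P)" "i < length T"
  shows "match_at P T i \<longleftrightarrow> pattern.Occ ((!) P) (length P) ((!) T) (Suc i) (length P)"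
proof -
  let ?m = "length P"
  let ?W = "take ?m (drop (Suc i - ?m) T)"
  have "length ?W = ?m" if "?m \<le> Suc i" using that assms(2) by simp
  moreover have "peq ((!) P) ((!) ?W) ?m \<longleftrightarrow> peq ((!) P) (\<lambda>x. T ! (Suc i - ?m + x)) ?m"
    if "?m \<le> Suc i"
    using that assms(2) by (intro peq_cong) auto
  ultimately show ?thesis
    by (auto simp: match_at_def pmatch_iff_peq pattern.Occ_def[OF assms(1)])
qed

lemma (in machine) stream_run_main:
  assumes P: "X = (!) P" "m = length P" and T: "length T = n" "set T \<subseteq> {..<sz}"
    and "rep ((!) T) F i s" "ready ((!) T) i s" "i \<le> n"
  shows "\<exists>s'. stream_run (ram_reaction w matcher (Suc (clen main_com))) (mem mem_size F) (drop i T) =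
    Some (s', map (match_at P T) [i..<n])"
  using assms(5-)
proof (induction "n - i" arbitrary: i F s)
  case 0
  then show ?case using T by simp
next
  case (Suc d)
  then have i: "i < n" by simp
  then have "T ! i < sz" using T by (auto simp: subset_iff)
  then obtain F' where F': "exec w mem_size main_com (F(0 := T ! i)) = Some F'"
    "rep ((!) T) F' (Suc i) (tick ((!) T) i s)" "F' 1 \<noteq> 0 \<longleftrightarrow> Occ ((!) T) (Suc i) m"
    using exec_main[OF Suc.prems(1,2) i] by metis
  have out: "(F' 1 \<noteq> 0) = match_at P T i"
    using F'(3) match_at_Occ[of P i T] i T P pattern_axioms by simp
  have r: "ram_reaction w matcher (Suc (clen main_com)) (T ! i) (mem mem_size F) =
    Some (mem mem_size F', match_at P T i)"
    using ram_reaction_code[OF F'(1)] out by simp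
  obtain s' where s': "stream_run (ram_reaction w matcher (Suc (clen main_com))) (mem mem_size F')
    (drop (Suc i) T) = Some (s', map (match_at P T) [Suc i..<n])"
  proof -
    have "d = n - Suc i" using Suc.hyps(2) by simp
    then show ?thesis
      using that Suc.hyps(1)[OF _ F'(2) ready_tick[OF Suc.prems(2)]] i by auto
  qed
  have "drop i T = T ! i # drop (Suc i) T" using i T by (simp add: Cons_nth_drop_Suc)
  then show ?case using r s' i by (simp add: upt_conv_Cons)
qed

lemma upper_bound:
  assumes P: "P \<in> patterns \<sigma> m \<rho>" and "m \<le> n" "64 * (n + \<sigma>) < 2 ^ w"
  shows "\<exists>M. set M \<subseteq> {..<2 ^ w} \<and> length M \<le> 64 * (\<sigma> + \<rho>) \<and>
    solves_pmatching \<sigma> n P (ram_reaction w matcher (Suc (clen main_com))) M"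
proof -
  have m: "0 < m" "m = length P" and rho: "\<rho> = per ((!) P) m"
    using P by (auto simp: patterns_def pperiod_eq_per)
  interpret machine "(!) P" m n \<sigma> w
    using assms(2,3) m by unfold_locales auto
  show ?thesis
  proof (intro exI conjI)
    show "set (mem mem_size init_mem) \<subseteq> {..<2 ^ w}" using init_mem_bound by auto
    show "length (mem mem_size init_mem) \<le> 64 * (\<sigma> + \<rho>)" using rho_pos by (simp add: rho)
    show "solves_pmatching \<sigma> n P (ram_reaction w matcher (Suc (clen main_com))) (mem mem_size init_mem)"
      unfolding solves_pmatching_def texts_def
      using stream_run_main[OF refl m(2) _ _ init_mem_rep ready_init] by fastforce
  qed
qed

section \<open>The lower bound\<close>

lemma stream_run_append:
  "stream_run \<delta> s (A @ B) =
     do { (s1, b1) \<leftarrow> stream_run \<delta> s A; (s2, b2) \<leftarrow> stream_run \<delta> s1 B; Some (s2, b1 @ b2) }"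
proof (induction A arbitrary: s)
  case Nil
  then show ?case by (cases "stream_run \<delta> s B") auto
next
  case (Cons x A)
  then show ?case
    by (auto simp: bind_eq_Some_conv split: bind_splits prod.splits)
qed

lemma stream_run_length: "stream_run \<delta> s A = Some (s', bs) \<Longrightarrow> length bs = length A"
  by (induction A arbitrary: s s' bs) (auto simp: bind_eq_Some_conv split: prod.splits)

lemma stream_run_prefix:
  assumes "solves_pmatching \<sigma> n P \<delta> s" "A @ B \<in> texts \<sigma> n"
  obtains s1 b1 s2 where "stream_run \<delta> s A = Some (s1, b1)"
    "stream_run \<delta> s1 B = Some (s2, map (match_at P (A @ B)) [length A..<n])"
proof -
  obtain s' where "stream_run \<delta> s (A @ B) = Some (s', map (match_at P (A @ B)) [0..<n])"
    using assms unfolding solves_pmatching_def by blast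
  then obtain s1 b1 s2 b2 where r: "stream_run \<delta> s A = Some (s1, b1)"
    "stream_run \<delta> s1 B = Some (s2, b2)" "b1 @ b2 = map (match_at P (A @ B)) [0..<n]"
    by (auto simp: stream_run_append bind_eq_Some_conv)
  have "length A \<le> n" using assms(2) by (auto simp: texts_def)
  then have "[0..<n] = [0..<length A] @ [length A..<n]"
    using upt_add_eq_append[of 0 "length A" "n - length A"] by simp
  then have "b2 = map (match_at P (A @ B)) [length A..<n]"
    using r(3) stream_run_length[OF r(1)] by (simp add: append_eq_append_conv)
  then show ?thesis using that r by simp
qed

text \<open>Patterns and initial states may differ as well: with one pattern this separates text
  prefixes, with empty \<open>A\<close> and \<open>A'\<close> it separates patterns.\<close>

lemma same_state_same_answer:
  assumes "solves_pmatching \<sigma> n P \<delta> s" "A @ B \<in> texts \<sigma> n"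
    and "solves_pmatching \<sigma> n P' \<delta> s'" "A' @ B \<in> texts \<sigma> n"
    and "fst (the (stream_run \<delta> s A)) = fst (the (stream_run \<delta> s' A'))"
    and "length A \<le> i" "i < n"
  shows "match_at P (A @ B) i \<longleftrightarrow> match_at P' (A' @ B) i"
proof -
  obtain s1 b1 s2 where 1: "stream_run \<delta> s A = Some (s1, b1)"
    "stream_run \<delta> s1 B = Some (s2, map (match_at P (A @ B)) [length A..<n])"
    using stream_run_prefix[OF assms(1,2)] .
  obtain t1 c1 t2 where 2: "stream_run \<delta> s' A' = Some (t1, c1)"
    "stream_run \<delta> t1 B = Some (t2, map (match_at P' (A' @ B)) [length A'..<n])"
    using stream_run_prefix[OF assms(3,4)] .
  have "length A' = length A" using assms(2,4) by (simp add: texts_def)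
  moreover have "t1 = s1" using 1(1) 2(1) assms(5) by simp
  ultimately show ?thesis using 1(2) 2(2) assms(6,7) by simp
qed

text \<open>Memory length may vary, so all shorter bit strings are counted together: there are
  \<open>2 ^ b - 1\<close> of length below \<open>b\<close>.\<close>

lemma long_state:
  fixes f :: "'i \<Rightarrow> bool list"
  assumes "finite I" "2 ^ b \<le> card I" "inj_on f I"
  shows "\<exists>i\<in>I. b \<le> length (f i)"
proof (rule ccontr)
  assume short: "\<not> ?thesis"
  have "I \<noteq> {}" using assms(2) by auto
  with short obtain b' where b: "b = Suc b'" by (cases b) auto
  have "f ` I \<subseteq> {xs. set xs \<subseteq> (UNIV :: bool set) \<and> length xs \<le> b'}"
    using short b by (auto simp: not_le)
  from card_mono[OF _ this] have "card I \<le> (\<Sum>i\<le>b'. 2 ^ i)"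
    using card_lists_length_le[of "UNIV :: bool set" b'] finite_lists_length_le[of "UNIV :: bool set" b']
    by (simp add: card_image[OF assms(3)])
  moreover have "(\<Sum>i\<le>b'. 2 ^ i) < (2 :: nat) ^ b"
    unfolding b by (induction b') simp_all
  ultimately show False using assms(2) by simp
qed

section \<open>Patterns with a prescribed p-period\<close>

lemma per_cong: "(\<And>i. i < m \<Longrightarrow> X i = Y i) \<Longrightarrow> per X m = per Y m"
proof -
  assume *: "\<And>i. i < m \<Longrightarrow> X i = Y i"
  have "peq X (\<lambda>i. X (p + i)) (m - p) \<longleftrightarrow> peq Y (\<lambda>i. Y (p + i)) (m - p)" for p
    using * by (intro peq_cong) auto
  then show ?thesis by (simp add: per_def)
qed

lemma per_eqI:
  assumes "0 < r" "peq X (\<lambda>i. X (r + i)) (m - r)"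
    and "\<And>p. 0 < p \<Longrightarrow> p < r \<Longrightarrow> \<not> peq X (\<lambda>i. X (p + i)) (m - p)"
  shows "per X m = r"
  using per_least[OF assms(1,2)] per_valid[of X m] assms(3)[of "per X m"] by (meson le_neq_implies_less)

lemma per_inj: "inj f \<Longrightarrow> per (\<lambda>i. f (X i)) m = per X m"
  by (simp add: per_def peq_def inj_eq)

lemma map_in_patterns:
  assumes "0 < m" "\<And>i. i < m \<Longrightarrow> X i < \<sigma>" "per X m = \<rho>"
  shows "map X [0..<m] \<in> patterns \<sigma> m \<rho>"
  using assms per_cong[of m "(!) (map X [0..<m])" X]
  by (auto simp: patterns_def pperiod_eq_per)

text \<open>A shift by \<open>m - 1\<close> compares single symbols, and over one symbol every shift
  works. By \<open>per_rainbow\<close> these necessary conditions are also sufficient.\<close>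

lemma patterns_nonempty_bounds:
  assumes "P \<in> patterns \<sigma> m \<rho>"
  shows "0 < \<sigma>" "0 < m" "0 < \<rho>" "1 < \<rho> \<Longrightarrow> \<rho> < m" "1 < \<rho> \<Longrightarrow> 1 < \<sigma>"
proof -
  have P: "0 < m" "length P = m" "set P \<subseteq> {..<\<sigma>}" "per ((!) P) m = \<rho>"
    using assms by (auto simp: patterns_def pperiod_eq_per)
  have lt: "P ! i < \<sigma>" if "i < m" for i using P that by (auto simp: subset_iff)
  show "0 < \<sigma>" "0 < m" "0 < \<rho>" using lt[of 0] P per_valid(1)[of "(!) P" m] by auto
  show "\<rho> < m" if "1 < \<rho>"
  proof -
    have "1 < m" using P that per_le[of m "(!) P"] by simp
    then have "per ((!) P) m \<le> m - 1" by (intro per_least) (auto simp: peq_def)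
    then show ?thesis using P by simp
  qed
  show "1 < \<sigma>" if "1 < \<rho>"
  proof (rule ccontr)
    assume "\<not> 1 < \<sigma>"
    then have "P ! i = 0" if "i < m" for i using lt[OF that] by simp
    then have "per ((!) P) m \<le> 1" by (intro per_least) (auto simp: peq_def)
    then show False using P that by simp
  qed
qed

lemma match_at_last:
  assumes "length P = m" "length W = m" "0 < m"
  shows "match_at P (W @ Z) (m - 1) \<longleftrightarrow> pmatch P W"
  using assms by (simp add: match_at_def)

lemma add_mod_cancel: "(a + c) mod n = (b + c) mod n \<longleftrightarrow> a mod n = b mod (n :: nat)"
  by (simp add: nat_mod_eq_iff algebra_simps)

text \<open>This pattern increases cyclically by one except between positions \<open>k * \<rho> - 1\<close> and \<open>k * \<rho>\<close>.
  It has p-period \<open>\<rho>\<close> and uses as many symbols as are needed.\<close>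

definition rainbow :: "nat \<Rightarrow> nat \<Rightarrow> nat \<Rightarrow> nat" where
  "rainbow \<sigma> \<rho> i = (if \<rho> = 1 then i else i - i div \<rho>) mod \<sigma>"

lemma rainbow_less: "0 < \<sigma> \<Longrightarrow> rainbow \<sigma> \<rho> i < \<sigma>"
  by (simp add: rainbow_def)

text \<open>Up to this position exactly \<open>i div (\<rho> - 1)\<close> repetitions have occurred.
  For \<open>\<rho> = 1\<close> division by zero gives 0, as it should.\<close>

lemma rainbow_onto:
  assumes "0 < \<rho>" "i < \<sigma>"
  shows "rainbow \<sigma> \<rho> (i + i div (\<rho> - 1)) = i"
proof (cases "\<rho> = 1")
  case True
  then show ?thesis using assms by (simp add: rainbow_def)
next
  case False
  define r where "r = \<rho> - 1"
  have r: "0 < r" "\<rho> = Suc r" using False assms by (auto simp: r_def)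
  have "i + i div r = i mod r + i div r * \<rho>"
    unfolding r(2) using mod_mult_div_eq[of i r] by (simp add: algebra_simps)
  moreover have "i mod r < \<rho>" using mod_less_divisor[OF r(1), of i] r(2) by linarith
  ultimately have "(i + i div r) div \<rho> = i div r" by (simp only: div_mult_self1) simp
  then show ?thesis using False assms by (simp only: rainbow_def r_def) simp
qed

lemma per_rainbow:
  assumes "0 < \<rho>" "1 < \<rho> \<Longrightarrow> \<rho> < m" "1 < \<rho> \<Longrightarrow> 1 < \<sigma>"
  shows "per (rainbow \<sigma> \<rho>) m = \<rho>"
proof (rule per_eqI)
  have "rainbow \<sigma> \<rho> (\<rho> + i) = rainbow \<sigma> \<rho> (\<rho> + j) \<longleftrightarrow> rainbow \<sigma> \<rho> i = rainbow \<sigma> \<rho> j" for i j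
  proof (cases "\<rho> = 1")
    case True
    then show ?thesis using add_mod_cancel[of i 1 \<sigma> j] by (simp add: rainbow_def)
  next
    case False
    have "rainbow \<sigma> \<rho> (\<rho> + i) = (i - i div \<rho> + (\<rho> - 1)) mod \<sigma>" for i
    proof -
      have "i div \<rho> \<le> i" by (rule div_le_dividend)
      then show ?thesis using False assms(1) by (simp add: rainbow_def algebra_simps)
    qed
    then show ?thesis
      using False add_mod_cancel[of "i - i div \<rho>" "\<rho> - 1" \<sigma> "j - j div \<rho>"] by (simp add: rainbow_def)
  qed
  then show "peq (rainbow \<sigma> \<rho>) (\<lambda>i. rainbow \<sigma> \<rho> (\<rho> + i)) (m - \<rho>)"
    by (auto simp: peq_def)
next
  fix p assume p: "0 < p" "p < \<rho>"
  then have m: "\<rho> < m" and \<sigma>: "1 < \<sigma>" using assms by auto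
  \<comment> \<open>The shift \<open>p\<close> aligns the repetition at \<open>\<rho> - 1\<close>
    and \<open>\<rho>\<close> with two neighbours in the first block, which carry different
    symbols.\<close>
  define i where "i = \<rho> - 1 - p"
  have i: "p + i = \<rho> - 1" "p + Suc i = \<rho>" "Suc i < \<rho>" using p by (auto simp: i_def)
  have "rainbow \<sigma> \<rho> (p + i) = rainbow \<sigma> \<rho> (p + Suc i)"
    unfolding i using p by (simp add: rainbow_def)
  moreover have "rainbow \<sigma> \<rho> i \<noteq> rainbow \<sigma> \<rho> (Suc i)"
  proof -
    have "i mod \<sigma> \<noteq> Suc i mod \<sigma>" using \<sigma> by (simp add: mod_Suc)
    then show ?thesis using i by (simp add: rainbow_def)
  qed
  moreover have "Suc i < m - p" using i m by linarith
  ultimately show "\<not> peq (rainbow \<sigma> \<rho>) (\<lambda>i. rainbow \<sigma> \<rho> (p + i)) (m - p)"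
    unfolding peq_def by (metis Suc_lessD)
qed (use assms in simp)

text \<open>Symbols \<open>i < h\<close> are sent to one element of the pair \<open>{2 * i, 2 * i + 1}\<close>, chosen by \<open>Y\<close>, and
  \<open>h + i\<close> is sent to the other one. An algorithm that has read the symbols below \<open>h\<close> must remember \<open>Y\<close>
  in order to reject a continuation that reuses a symbol.\<close>

definition recolour :: "nat \<Rightarrow> nat set \<Rightarrow> nat \<Rightarrow> nat" where
  "recolour h Y i =
    (if i < h then 2 * i + of_bool (i \<in> Y)
     else if i < 2 * h then 2 * (i - h) + of_bool (i - h \<notin> Y)
     else i)"

lemma recolour_less: "2 * h \<le> \<sigma> \<Longrightarrow> i < \<sigma> \<Longrightarrow> recolour h Y i < \<sigma>"
  by (auto simp: recolour_def)

lemma double_add_bit_eq: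
  "2 * a + of_bool p = 2 * b + (of_bool q :: nat) \<longleftrightarrow> a = b \<and> p = q"
proof -
  have "a = b \<and> p = q" if "2 * a + of_bool p = 2 * b + (of_bool q :: nat)"
    using that by (cases p; cases q) (simp_all, presburger+)
  then show ?thesis by blast
qed

lemma inj_recolour: "inj (recolour h Y)"
proof (rule injI)
  fix i j assume eq: "recolour h Y i = recolour h Y j"
  have "2 * a + of_bool p < 2 * h" if "a < h" for a and p :: bool
    using that by (cases p) auto
  then have small: "recolour h Y i < 2 * h \<longleftrightarrow> i < 2 * h" for i
    by (auto simp: recolour_def)
  consider "i < h" "j < h" | "i < h" "h \<le> j" "j < 2 * h" | "h \<le> i" "i < 2 * h" "j < h"
    | "h \<le> i" "i < 2 * h" "h \<le> j" "j < 2 * h" | "2 * h \<le> i" "2 * h \<le> j"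
    using eq small[of i] small[of j] by linarith
  then show "i = j"
  proof cases
    case 1
    then show ?thesis using eq by (simp add: recolour_def double_add_bit_eq)
  next
    case 2
    then show ?thesis using eq by (simp add: recolour_def double_add_bit_eq) blast
  next
    case 3
    then show ?thesis using eq by (simp add: recolour_def double_add_bit_eq) blast
  next
    case 4
    then have "i - h = j - h" using eq by (simp add: recolour_def double_add_bit_eq)
    then show ?thesis using 4 by simp
  next
    case 5
    then have "\<not> i < h" "\<not> j < h" by auto
    then show ?thesis using eq 5 by (simp add: recolour_def)
  qed
qed

lemma alphabet_lower_bound:
  fixes init :: "nat list \<Rightarrow> bool list" and \<delta> :: "bool list reaction"
  assumes bounds: "0 < m" "0 < \<rho>" "1 < \<rho> \<Longrightarrow> \<rho> < m" "1 < \<rho> \<Longrightarrow> 1 < \<sigma>" "0 < \<sigma>"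
    and "\<sigma> \<le> m" "m \<le> n"
    and solves: "\<And>P. P \<in> patterns \<sigma> m \<rho> \<Longrightarrow> solves_pmatching \<sigma> n P \<delta> (init P)"
  shows "\<exists>P \<in> patterns \<sigma> m \<rho>. \<exists>k \<le> n. \<exists>T \<in> texts \<sigma> k. \<exists>s bs.
    stream_run \<delta> (init P) T = Some (s, bs) \<and> \<sigma> div 4 \<le> length s"
proof -
  \<comment> \<open>One factor 2 is for the two halves of symbols, the other for
    \<open>pos i \<le> 2 * i\<close>; together they keep the positions below
    \<open>\<sigma>\<close>, hence below \<open>m\<close>.\<close>
  define h where "h = \<sigma> div 4"
  define X where "X = rainbow \<sigma> \<rho>"
  define P where "P = map X [0..<m]"
  define pos where "pos i = i + i div (\<rho> - 1)" for i
  define k where "k = pos h"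
  define A where "A Y = map (recolour h Y) (take k P)" for Y
  define B where "B Y = map (recolour h Y) (drop k P) @ replicate (n - m) 0" for Y
  define st where "st Y = fst (the (stream_run \<delta> (init P) (A Y)))" for Y
  have P: "P \<in> patterns \<sigma> m \<rho>" unfolding P_def X_def
    using bounds by (intro map_in_patterns per_rainbow rainbow_less)
  have posm: "i < 2 * h \<Longrightarrow> pos i < m" for i
  proof -
    assume "i < 2 * h"
    moreover have "i div (\<rho> - 1) \<le> i" by (rule div_le_dividend)
    ultimately show "pos i < m" using \<open>\<sigma> \<le> m\<close> unfolding pos_def h_def by linarith
  qed
  have pos_mono: "i \<le> j \<Longrightarrow> pos i \<le> pos j" for i j
    unfolding pos_def by (intro add_mono div_le_mono)
  have pos_strict: "i < h \<Longrightarrow> pos i < k" for i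
    unfolding k_def pos_def using div_le_mono[of i h "\<rho> - 1"] by linarith
  have Ppos: "P ! pos i = i" if "i < 2 * h" for i
    using posm[OF that] rainbow_onto[of \<rho> i \<sigma>] that bounds by (simp add: P_def X_def pos_def h_def)
  have lenP: "length P = m" by (simp add: P_def)
  have AB: "A Y @ B Z \<in> texts \<sigma> n" for Y Z
  proof -
    have "x < \<sigma>" if "x \<in> set P" for x
      using that P by (auto simp: patterns_def)
    then have "recolour h Y x < \<sigma>" if "x \<in> set P" for x Y
      using that by (intro recolour_less) (auto simp: h_def)
    then show ?thesis
      using \<open>m \<le> n\<close> lenP bounds(5) unfolding texts_def A_def B_def
      by (auto dest: in_set_takeD in_set_dropD)
  qed
  have kle: "k \<le> m - 1 \<or> h = 0"
    using posm[of h] by (cases "h = 0") (auto simp: k_def)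
  have inj: "inj_on st (Pow {..<h})"
  proof (rule inj_onI)
    fix Y Z assume YZ: "Y \<in> Pow {..<h}" "Z \<in> Pow {..<h}" and eq: "st Y = st Z"
    show "Y = Z"
    proof (cases "h = 0")
      case False
      let ?W = "A Z @ map (recolour h Y) (drop k P)"
      have k: "k \<le> m - 1" "k < m" using kle False bounds(1) by auto
      have lenA: "length (A Y) = k" for Y using k lenP by (simp add: A_def)
      have "match_at P (A Y @ B Y) (m - 1) \<longleftrightarrow> match_at P (A Z @ B Y) (m - 1)"
      proof (rule same_state_same_answer[OF solves[OF P] AB[of Y Y] solves[OF P] AB[of Z Y]])
        show "fst (the (stream_run \<delta> (init P) (A Y))) = fst (the (stream_run \<delta> (init P) (A Z)))"
          using eq by (simp add: st_def)
        show "length (A Y) \<le> m - 1" "m - 1 < n"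
          using k lenA \<open>m \<le> n\<close> bounds(1) by auto
      qed
      moreover have "A Y @ B Y = map (recolour h Y) P @ replicate (n - m) 0"
        by (simp add: A_def B_def flip: map_append)
      moreover have "pmatch P (map (recolour h Y) P)"
        unfolding pmatch_def using inj_recolour[of h Y] by (auto intro: inj_on_subset)
      moreover have "match_at P (A Z @ B Y) (m - 1) \<longleftrightarrow> pmatch P ?W"
        using match_at_last[of P m ?W] lenP lenA k bounds(1) by (simp add: B_def)
      ultimately have W: "pmatch P ?W"
        using match_at_last[of P m "map (recolour h Y) P"] lenP bounds(1) by simp
      \<comment> \<open>If \<open>Y\<close> and \<open>Z\<close> disagree on \<open>i\<close>, the
        prefix recoloured by \<open>Z\<close> and the rest recoloured by \<open>Y\<close> give the
        different symbols \<open>i\<close> and \<open>h + i\<close> the same colour.\<close>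
      have "i \<in> Y \<longleftrightarrow> i \<in> Z" if i: "i < h" for i
      proof -
        let ?x = "pos i" and ?y = "pos (h + i)"
        have x: "?x < k" "?x < m" using pos_strict[OF i] k by auto
        have y: "k \<le> ?y" "?y < m" using pos_mono[of h "h + i"] posm[of "h + i"] i by (auto simp: k_def)
        have Px: "P ! ?x = i" "P ! ?y = h + i" using Ppos i by auto
        have "?W ! ?x \<noteq> ?W ! ?y"
        proof -
          have "peq ((!) P) ((!) ?W) m" using W lenP by (simp add: pmatch_iff_peq)
          then have "P ! ?x = P ! ?y \<longleftrightarrow> ?W ! ?x = ?W ! ?y"
            using x(2) y(2) unfolding peq_def by blast
          then show ?thesis using Px i by simp
        qed
        moreover have "?W ! ?x = 2 * i + of_bool (i \<in> Z)"
          using x lenA[of Z] lenP Px i by (simp add: nth_append A_def recolour_def)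
        moreover have "?W ! ?y = 2 * i + of_bool (i \<notin> Y)"
          using y lenA[of Z] lenP Px i by (simp add: nth_append recolour_def)
        ultimately show ?thesis using double_add_bit_eq by metis
      qed
      then show ?thesis using YZ by blast
    qed (use YZ in simp)
  qed
  from long_state[OF _ _ this, of h] obtain Y where Y: "h \<le> length (st Y)"
    by (auto simp: card_Pow)
  obtain s b where "stream_run \<delta> (init P) (A Y) = Some (s, b)"
    using stream_run_prefix[OF solves[OF P] AB] by metis
  moreover have "A Y \<in> texts \<sigma> (length (A Y))" "length (A Y) \<le> n"
    using AB[of Y Y] by (auto simp: texts_def)
  ultimately show ?thesis using P Y by (force simp: st_def h_def)
qed

text \<open>Two Boolean strings p-match iff their difference sequences agree. A difference sequence whose
  first \<open>\<rho>\<close> entries begin with \<open>\<rho> div 2\<close> times \<^term>\<open>False\<close> and end with \<^term>\<open>True\<close>, repeated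
  periodically, has no period below \<open>\<rho>\<close>.\<close>

fun parity :: "(nat \<Rightarrow> bool) \<Rightarrow> nat \<Rightarrow> bool" where
  "parity D 0 = False"
| "parity D (Suc i) = (parity D i \<noteq> D i)"

lemma peq_parity:
  assumes "peq (parity D) (\<lambda>i. parity E (p + i)) l" "Suc i < l"
  shows "D i = E (p + i)"
proof -
  have "parity D i = parity D (Suc i) \<longleftrightarrow> parity E (p + i) = parity E (p + Suc i)"
    using assms unfolding peq_def by (meson Suc_lessD)
  then show ?thesis by auto
qed

text \<open>A smaller period \<open>p\<close> would carry the final True down in steps of
  \<open>p\<close>. The first step must stay above the False half, so \<open>p\<close> is at most
  \<open>\<rho> div 2\<close>, and the last step, to \<open>(\<rho> - 1) mod p\<close>, falls into
  that half.\<close>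

lemma per_parity:
  assumes Y: "Y \<subseteq> {\<rho> div 2..<\<rho> - 1}" and \<rho>: "1 < \<rho>" "\<rho> < m"
  shows "per (parity (\<lambda>i. i mod \<rho> \<in> insert (\<rho> - 1) Y)) m = \<rho>"
proof (rule per_eqI)
  let ?D = "\<lambda>i. i mod \<rho> \<in> insert (\<rho> - 1) Y"
  \<comment> \<open>A shift by \<open>\<rho>\<close> keeps or complements the whole string, and both
    are injective renamings.\<close>
  have "parity ?D (\<rho> + i) = (parity ?D \<rho> \<noteq> parity ?D i)" for i
    by (induction i) (auto simp del: insert_iff)
  then show "peq (parity ?D) (\<lambda>i. parity ?D (\<rho> + i)) (m - \<rho>)"
    by (auto simp: peq_def simp del: insert_iff)
next
  let ?D = "\<lambda>i. i mod \<rho> \<in> insert (\<rho> - 1) Y"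
  fix p assume p: "0 < p" "p < \<rho>"
  show "\<not> peq (parity ?D) (\<lambda>i. parity ?D (p + i)) (m - p)"
  proof
    assume eq: "peq (parity ?D) (\<lambda>i. parity ?D (p + i)) (m - p)"
    have D: "?D i = ?D (p + i)" if "p + i < \<rho>" for i
      using peq_parity[OF eq, of i] that \<rho> by simp
    have low: "\<not> ?D i" if "i < \<rho> div 2" for i
      using that Y by auto
    have top: "?D (\<rho> - 1 - j * p)" if "j * p < \<rho>" for j
      using that
    proof (induction j)
      case 0
      then show ?case using \<rho> by simp
    next
      case (Suc j)
      then have "p + (\<rho> - 1 - Suc j * p) = \<rho> - 1 - j * p \<or> \<rho> \<le> Suc j * p" by auto
      then show ?case using Suc D[of "\<rho> - 1 - Suc j * p"] p by auto
    qed
    have "\<rho> - 1 - 1 * p \<ge> \<rho> div 2" using top[of 1] low p by (simp add: not_less[symmetric]) blast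
    define j where "j = (\<rho> - 1) div p"
    have "\<rho> - 1 - j * p = (\<rho> - 1) mod p" by (simp add: j_def minus_div_mult_eq_mod)
    moreover have "(\<rho> - 1) mod p < p" using p by simp
    moreover have "j * p < \<rho>" 
      using \<rho> div_times_less_eq_dividend[of "\<rho> - 1" p] unfolding j_def by linarith
    ultimately have "\<rho> - 1 - j * p < \<rho> div 2" "j * p < \<rho>"
      using \<open>\<rho> - 1 - 1 * p \<ge> \<rho> div 2\<close> \<rho> by linarith+
    then show False using top[of j] low by blast
  qed
qed (use \<rho> in simp)

text \<open>The initial memory alone must separate the patterns: on a text that begins with one of
  them, equal memories would force the two to p-match.\<close>

lemma period_lower_bound:
  fixes init :: "nat list \<Rightarrow> bool list" and \<delta> :: "bool list reaction"
  assumes bounds: "1 < \<rho>" "\<rho> < m" "1 < \<sigma>" "m \<le> n"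
    and solves: "\<And>P. P \<in> patterns \<sigma> m \<rho> \<Longrightarrow> solves_pmatching \<sigma> n P \<delta> (init P)"
  shows "\<exists>P \<in> patterns \<sigma> m \<rho>. (\<rho> - 1) div 2 \<le> length (init P)"
proof -
  define h where "h = \<rho> div 2"
  define D where "D Y i \<longleftrightarrow> i mod \<rho> \<in> insert (\<rho> - 1) Y" for Y i
  define P where "P Y = map (\<lambda>i. of_bool (parity (D Y) i) :: nat) [0..<m]" for Y
  have P: "P Y \<in> patterns \<sigma> m \<rho>" if "Y \<in> Pow {h..<\<rho> - 1}" for Y
  proof -
    have "per (\<lambda>i. of_bool (parity (D Y) i) :: nat) m = per (parity (D Y)) m"
      by (rule per_inj) (simp add: inj_def)
    then show ?thesis
      unfolding P_def using bounds per_parity[of Y \<rho> m] that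
      by (intro map_in_patterns) (auto simp: h_def D_def[abs_def])
  qed
  have inj: "inj_on (\<lambda>Y. init (P Y)) (Pow {h..<\<rho> - 1})"
  proof (rule inj_onI)
    fix Y Z assume YZ: "Y \<in> Pow {h..<\<rho> - 1}" "Z \<in> Pow {h..<\<rho> - 1}" and eq: "init (P Y) = init (P Z)"
    let ?T = "P Y @ replicate (n - m) 0"
    have len: "length (P Y) = m" for Y by (simp add: P_def)
    have T: "?T \<in> texts \<sigma> n" using P[OF YZ(1)] bounds len by (auto simp: texts_def patterns_def)
    have "match_at (P Y) ([] @ ?T) (m - 1) \<longleftrightarrow> match_at (P Z) ([] @ ?T) (m - 1)"
      by (rule same_state_same_answer[OF solves[OF P] _ solves[OF P]])
        (use YZ T eq bounds in auto)
    then have "pmatch (P Z) (P Y)"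
      using match_at_last[OF len len] bounds by (auto simp: pmatch_iff_peq peq_refl)
    then have "peq ((!) (P Z)) ((!) (P Y)) m" by (simp add: pmatch_iff_peq len)
    then have "peq (parity (D Z)) (\<lambda>i. parity (D Y) (0 + i)) m"
      by (simp add: peq_def P_def of_bool_eq_iff)
    then have *: "D Z i = D Y i" if "Suc i < m" for i
      using peq_parity[of "D Z" "D Y" 0 m i] that by simp
    have "i \<in> Z \<longleftrightarrow> i \<in> Y" if "i < \<rho> - 1" for i
    proof -
      have "i mod \<rho> = i" "Suc i < m" "i \<noteq> \<rho> - 1" using that bounds by auto
      then show ?thesis using *[of i] by (simp add: D_def)
    qed
    then show "Y = Z" using YZ by auto
  qed
  have "(\<rho> - 1) div 2 \<le> \<rho> - 1 - h" using bounds by (simp add: h_def)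
  then have "(2 :: nat) ^ ((\<rho> - 1) div 2) \<le> card (Pow {h..<\<rho> - 1})"
    by (simp add: card_Pow)
  from long_state[OF _ this inj] show ?thesis using P by auto
qed

lemma lower_bound:
  fixes init :: "nat list \<Rightarrow> bool list" and \<delta> :: "bool list reaction"
  assumes "patterns \<sigma> m \<rho> \<noteq> {}" "\<sigma> \<le> m" "m \<le> n" "16 \<le> \<sigma> + \<rho>"
    and solves: "\<And>P. P \<in> patterns \<sigma> m \<rho> \<Longrightarrow> solves_pmatching \<sigma> n P \<delta> (init P)"
  shows "\<exists>P \<in> patterns \<sigma> m \<rho>. \<exists>k \<le> n. \<exists>T \<in> texts \<sigma> k. \<exists>s bs.
    stream_run \<delta> (init P) T = Some (s, bs) \<and> 1 / 16 * real (\<sigma> + \<rho>) \<le> real (length s)"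
proof -
  obtain P0 where "P0 \<in> patterns \<sigma> m \<rho>" using assms(1) by auto
  note bounds = patterns_nonempty_bounds[OF this]
  show ?thesis
  proof (cases "\<rho> \<le> \<sigma>")
    \<comment> \<open>The larger of \<open>\<sigma>\<close> and \<open>\<rho>\<close> is at least
      half of the sum; the threshold 16 absorbs the rounding in \<open>\<sigma> div 4\<close> and
      \<open>(\<rho> - 1) div 2\<close>.\<close>
    case True
    have "1 / 16 * real (\<sigma> + \<rho>) \<le> real l" if "\<sigma> div 4 \<le> l" for l
    proof -
      have "\<sigma> + \<rho> \<le> 16 * l" using that True assms(4) by linarith
      then have "real (\<sigma> + \<rho>) \<le> real (16 * l)" by (simp only: of_nat_le_iff)
      then show ?thesis by simp
    qed
    then show ?thesis
      using alphabet_lower_bound[OF bounds(2,3,4,5,1) assms(2,3) solves] by meson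
  next
    case False
    then have \<rho>: "1 < \<rho>" using assms(4) by simp
    obtain P where P: "P \<in> patterns \<sigma> m \<rho>" "(\<rho> - 1) div 2 \<le> length (init P)"
      using period_lower_bound[OF \<rho> bounds(4)[OF \<rho>] bounds(5)[OF \<rho>] assms(3) solves] by blast
    have "1 / 16 * real (\<sigma> + \<rho>) \<le> real (length (init P))"
    proof -
      have "\<sigma> + \<rho> \<le> 16 * length (init P)" using P(2) False assms(4) by linarith
      then have "real (\<sigma> + \<rho>) \<le> real (16 * length (init P))" by (simp only: of_nat_le_iff)
      then show ?thesis by simp
    qed
    moreover have "stream_run \<delta> (init P) [] = Some (init P, [])" "[] \<in> texts \<sigma> 0"
      by (simp_all add: texts_def)
    ultimately show ?thesis using P(1) by blast
  qed
qed

section \<open>The theorem\<close>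

theorem theorem4:
  shows
    "(\<exists>(prog :: instr list) (t :: nat) (C :: nat).
        \<forall>\<sigma> m \<rho> n w. \<forall>P \<in> patterns \<sigma> m \<rho>.
          m \<le> n \<and> C * (n + \<sigma>) < 2 ^ w \<longrightarrow>
          (\<exists>M. set M \<subseteq> {..<2 ^ w} \<and> length M \<le> C * (\<sigma> + \<rho>) \<and>
               solves_pmatching \<sigma> n P (ram_reaction w prog t) M))
     \<and>
     (\<exists>(c :: real) > 0. \<exists>N :: nat.
        \<forall>\<sigma> m \<rho> n. patterns \<sigma> m \<rho> \<noteq> {} \<and> \<sigma> \<le> m \<and> m \<le> n \<and> N \<le> \<sigma> + \<rho> \<longrightarrow>
          (\<forall>(init :: nat list \<Rightarrow> bool list) (\<delta> :: bool list reaction).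
             (\<forall>P \<in> patterns \<sigma> m \<rho>. solves_pmatching \<sigma> n P \<delta> (init P)) \<longrightarrow>
             (\<exists>P \<in> patterns \<sigma> m \<rho>. \<exists>k \<le> n. \<exists>T \<in> texts \<sigma> k. \<exists>s bs.
                stream_run \<delta> (init P) T = Some (s, bs) \<and>
                c * real (\<sigma> + \<rho>) \<le> real (length s))))"
proof (intro conjI)
  show "\<exists>(prog :: instr list) (t :: nat) (C :: nat).
    \<forall>\<sigma> m \<rho> n w. \<forall>P \<in> patterns \<sigma> m \<rho>.
      m \<le> n \<and> C * (n + \<sigma>) < 2 ^ w \<longrightarrow>
      (\<exists>M. set M \<subseteq> {..<2 ^ w} \<and> length M \<le> C * (\<sigma> + \<rho>) \<and>
           solves_pmatching \<sigma> n P (ram_reaction w prog t) M)"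
    using upper_bound by blast
  show "\<exists>(c :: real) > 0. \<exists>N :: nat.
    \<forall>\<sigma> m \<rho> n. patterns \<sigma> m \<rho> \<noteq> {} \<and> \<sigma> \<le> m \<and> m \<le> n \<and> N \<le> \<sigma> + \<rho> \<longrightarrow>
      (\<forall>(init :: nat list \<Rightarrow> bool list) (\<delta> :: bool list reaction).
         (\<forall>P \<in> patterns \<sigma> m \<rho>. solves_pmatching \<sigma> n P \<delta> (init P)) \<longrightarrow>
         (\<exists>P \<in> patterns \<sigma> m \<rho>. \<exists>k \<le> n. \<exists>T \<in> texts \<sigma> k. \<exists>s bs.
            stream_run \<delta> (init P) T = Some (s, bs) \<and>
            c * real (\<sigma> + \<rho>) \<le> real (length s)))"
  proof (intro exI[of _ "1 / 16 :: real"] conjI exI[of _ 16] allI impI)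
    show "(0 :: real) < 1 / 16" by simp
  qed (elim conjE, rule lower_bound; blast)
qed

end
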